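(* Let $U_1,U_2,\dots$ be independent and uniformly distributed random points on the unit circle $\mathbb{S}\subset\mathbb{R}^2$, and let $$H_n=\max_{1\le i<j<\ell\le n}\operatorname{peri}(U_i,U_j,U_\ell).$$ Then for all $t>0$, $$\lim_{n\to\infty}\mathbf{P}\{n^3(3\sqrt{3}-H_n)\le t\}=1-\exp\left\{-\frac{2t}{9\pi}\right\},$$ and for finite $t$ the rate of convergence is $\mathcal{O}(n^{-1/2})$, i.e. for each fixed $t\in(0,\infty)$ the absolute difference between $\mathbf{P}\{n^3(3\sqrt{3}-H_n)\le t\}$ and its limit is $\mathcal{O}(n^{-1/2})$ as $n\to\infty$.
   Context: For points $x_1,x_2,x_3$, $\operatorname{peri}(x_1,x_2,x_3)=\|x_1-x_2\|+\|x_2-x_3\|+\|x_3-x_1\|$ is the perimeter of the triangle with vertices $x_1,x_2,x_3$, with $\|\cdot\|$ the Euclidean norm. *)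

theory Defs
  imports "HOL-Probability.Probability" "HOL-Library.Landau_Symbols"
begin

definition peri :: "real^2 \<Rightarrow> real^2 \<Rightarrow> real^2 \<Rightarrow> real" where
  "peri x y z = norm (x - y) + norm (y - z) + norm (z - x)"

definition circle_point :: "real \<Rightarrow> real^2" where
  "circle_point \<theta> = vector [cos \<theta>, sin \<theta>]"

text \<open>
  The uniform distribution on the unit circle, i.e. normalised arc length, as a measure on
  the Borel sets of the plane: arc length is the image of Lebesgue measure under the
  unit-speed parametrisation by the angle.
\<close>

definition uniform_circle :: "(real^2) measure" where
  "uniform_circle = distr (uniform_measure lborel {0..2 * pi}) borel circle_point"

text \<open>
  Only meaningful for \<open>n \<ge> 3\<close>; for smaller \<open>n\<close> the maximum is over the empty set and has an
  unspecified value.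
\<close>

definition max_peri :: "(nat \<Rightarrow> real^2) \<Rightarrow> nat \<Rightarrow> real" where
  "max_peri u n = Max {peri (u i) (u j) (u l) | i j l. 1 \<le> i \<and> i < j \<and> j < l \<and> l \<le> n}"

lemma circle_point_measurable [measurable]: "circle_point \<in> borel_measurable borel"
proof -
  have *: "circle_point = (\<lambda>\<theta>. \<chi> i. if i = 1 then cos \<theta> else sin \<theta>)"
    by (simp add: fun_eq_iff circle_point_def vec_eq_iff forall_2)
  have "continuous_on UNIV (\<lambda>\<theta>::real. if i = 1 then cos \<theta> else sin \<theta>)" for i :: 2
    by (cases "i = 1") (simp_all add: continuous_at_imp_continuous_on)
  then have "continuous_on UNIV circle_point"
    unfolding * by (rule continuous_on_vec_lambda)
  then show ?thesis by (rule borel_measurable_continuous_onI)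
qed

lemma norm_circle_point: "norm (circle_point \<theta>) = 1"
  by (simp add: circle_point_def norm_vec_def L2_set_def sum_2)

lemma prob_space_uniform_circle: "prob_space uniform_circle"
  unfolding uniform_circle_def
  by (intro prob_space.prob_space_distr prob_space_uniform_measure) auto

lemma uniform_circle_sphere: "measure uniform_circle (sphere 0 1) = 1"
proof -
  interpret prob_space "uniform_measure lborel {0..2 * pi}"
    by (rule prob_space_uniform_measure) auto
  have "circle_point -` sphere 0 1 = UNIV" by (auto simp: norm_circle_point)
  then show ?thesis
    unfolding uniform_circle_def using prob_space
    by (subst measure_distr) (auto simp: borel_closed)
qed

end

theory Submission
  imports Defs
begin

text \<open>
  Call a triple of sample points near-equilateral if its perimeter is at least \<open>3 sqrt 3 - e\<close> with
  \<open>e = t / n^3\<close>, and let \<open>W\<close> be the number of such triples. In terms of the deviations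
  \<open>h\<^sub>i\<close> of the half central angles from \<open>pi / 3\<close>, the perimeter defect is
  \<open>(sqrt 3 / 2) (h\<^sub>1^2 + h\<^sub>2^2 + h\<^sub>3^2)\<close> up to a cubic error, so near-equilateral triples
  correspond to two almost elliptic regions of angles, whence a triple is near-equilateral with
  probability \<open>4 e / (3 pi) + O(e^(3/2))\<close> and \<open>E W = 2 t / (9 pi) + O(n^(-1/2))\<close>.

  The generating function \<open>G(s) = E s^W\<close> nearly satisfies \<open>G' = (E W) G\<close>, because indicators of
  disjoint triples are independent; integrating from 0 to 1 shows that \<open>P(W = 0)\<close> is close to
  \<open>exp (- E W)\<close>, with an error made of the correlations between intersecting triples. If two
  near-equilateral triples share a point, then every other point of theirs is within
  \<open>O(sqrt e)\<close> of one of two positions determined by the shared one, so the pair has probability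
  \<open>O(e^2)\<close> when one point is shared and \<open>O(e^(3/2))\<close> when two are. The latter case, with its
  \<open>O(n^4)\<close> pairs, gives the rate \<open>n^(-1/2)\<close>.
\<close>

section \<open>Poisson approximation of void probabilities\<close>

lemma measurable_card_Collect:
  assumes "finite J" "\<And>j. j \<in> J \<Longrightarrow> {x\<in>space M. P j x} \<in> sets M"
  shows "(\<lambda>x. card {j\<in>J. P j x}) \<in> measurable M (count_space UNIV)"
proof -
  have "(\<lambda>x. \<Sum>j\<in>J. if P j x then 1 else 0 :: nat) \<in> measurable M (count_space UNIV)"
    using assms(2) by (intro measurable_sum_nat measurable_If) auto
  then show ?thesis using assms(1) by (simp add: sum.If_cases Int_def)
qed

text \<open>A Stein-Chen type bound with dependency neighbourhoods \<open>N \<alpha>\<close>,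
  obtained from the generating function of the count alone. Independence is therefore asked only in
  the form in which it is used: the indicator of \<open>E \<alpha>\<close> is uncorrelated with
  \<open>s ^ w (I - N \<alpha>)\<close>.\<close>

lemma (in prob_space) poisson_void_bound:
  fixes E :: "'i \<Rightarrow> 'a set" and N :: "'i \<Rightarrow> 'i set" and I :: "'i set"
  defines "w \<equiv> \<lambda>J \<omega>. card {\<beta>\<in>J. \<omega> \<in> E \<beta>}"
  assumes fin: "finite I" and E: "\<And>\<alpha>. \<alpha> \<in> I \<Longrightarrow> E \<alpha> \<in> events"
    and NI: "\<And>\<alpha>. \<alpha> \<in> I \<Longrightarrow> N \<alpha> \<subseteq> I" and Na: "\<And>\<alpha>. \<alpha> \<in> I \<Longrightarrow> \<alpha> \<in> N \<alpha>"
    and indep: "\<And>\<alpha> s. \<alpha> \<in> I \<Longrightarrow> 0 \<le> s \<Longrightarrow> s \<le> 1 \<Longrightarrow>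
        expectation (\<lambda>\<omega>. indicator (E \<alpha>) \<omega> * s ^ w (I - N \<alpha>) \<omega>)
          = prob (E \<alpha>) * expectation (\<lambda>\<omega>. s ^ w (I - N \<alpha>) \<omega>)"
  shows "\<bar>prob {\<omega>\<in>space M. \<forall>\<alpha>\<in>I. \<omega> \<notin> E \<alpha>} - exp (- (\<Sum>\<alpha>\<in>I. prob (E \<alpha>)))\<bar>
          \<le> (\<Sum>\<alpha>\<in>I. (\<Sum>\<beta>\<in>N \<alpha>. prob (E \<alpha>) * prob (E \<beta>)) + (\<Sum>\<beta>\<in>N \<alpha> - {\<alpha>}. prob (E \<alpha> \<inter> E \<beta>)))"
    (is "_ \<le> ?B")
proof -
  define lam where "lam = (\<Sum>\<alpha>\<in>I. prob (E \<alpha>))"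
  have lam0: "lam \<ge> 0" by (simp add: lam_def sum_nonneg)
  have fJ: "finite J" if "J \<subseteq> I" for J using that fin finite_subset by blast
  have w_meas: "w J \<in> measurable M (count_space UNIV)" if "J \<subseteq> I" for J
  proof -
    have "{\<omega>\<in>space M. \<omega> \<in> E j} \<in> events" if "j \<in> J" for j
      using E[of j] that \<open>J \<subseteq> I\<close> sets.sets_into_space[of "E j" M]
      by (simp add: Int_def[symmetric] Int_absorb1 subset_iff Collect_conj_eq inf.absorb2)
    then show ?thesis unfolding w_def by (intro measurable_card_Collect fJ that)
  qed
  have F_meas: "(\<lambda>\<omega>. F (w J \<omega>)) \<in> borel_measurable M" if "J \<subseteq> I" for J and F :: "nat \<Rightarrow> real"
    using measurable_compose[OF w_meas[OF that], of F borel] by simp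
  have w_le: "w I \<omega> \<le> card I" for \<omega>
    unfolding w_def by (rule card_mono[OF fin]) auto
  have pow_int: "integrable M (\<lambda>\<omega>. s ^ w J \<omega>)" if "J \<subseteq> I" "0 \<le> s" "s \<le> 1" for J and s :: real
    by (rule integrable_const_bound[of _ 1]) (use that in \<open>auto intro!: F_meas[of _ "\<lambda>k. s ^ k"] power_le_one\<close>)
  have pow1_int: "integrable M (\<lambda>\<omega>. s ^ (w J \<omega> - 1))" if "J \<subseteq> I" "0 \<le> s" "s \<le> 1" for J and s :: real
    by (rule integrable_const_bound[of _ 1]) (use that in \<open>auto intro!: F_meas[of _ "\<lambda>k. s ^ (k-Suc 0)"] power_le_one\<close>)
  have ind_int: "integrable M (indicat_real (E \<alpha>))" if "\<alpha> \<in> I" for \<alpha>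
    using E[OF that] by (simp add: integrable_real_indicator emeasure_eq_measure)
  have lev: "{\<omega>\<in>space M. w I \<omega> = k} \<in> events" for k
    using w_meas[of I] by measurable
  \<comment> \<open>The count takes finitely many values, so its generating function is a polynomial
    and can be differentiated term by term.\<close>
  have expand: "expectation (\<lambda>\<omega>. F (w I \<omega>)) = (\<Sum>k\<le>card I. F k * prob {\<omega>\<in>space M. w I \<omega> = k})"
    for F :: "nat \<Rightarrow> real"
  proof -
    have "expectation (\<lambda>\<omega>. F (w I \<omega>))
        = expectation (\<lambda>\<omega>. \<Sum>k\<le>card I. F k * indicat_real {\<omega>\<in>space M. w I \<omega> = k} \<omega>)"
    proof (rule Bochner_Integration.integral_cong)
      fix \<omega> assume "\<omega> \<in> space M"
      then have "(\<Sum>k\<le>card I. F k * indicat_real {\<omega>\<in>space M. w I \<omega> = k} \<omega>)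
          = (\<Sum>k\<le>card I. if k = w I \<omega> then F k else 0)"
        by (intro sum.cong) (auto simp: indicator_def)
      also have "\<dots> = F (w I \<omega>)" using w_le[of \<omega>] by (simp add: sum.delta)
      finally show "F (w I \<omega>) = (\<Sum>k\<le>card I. F k * indicat_real {\<omega>\<in>space M. w I \<omega> = k} \<omega>)" by simp
    qed simp
    also have "\<dots> = (\<Sum>k\<le>card I. F k * prob {\<omega>\<in>space M. w I \<omega> = k})"
      using lev by (subst Bochner_Integration.integral_sum) (auto simp: emeasure_eq_measure)
    finally show ?thesis .
  qed
  define G where "G s = expectation (\<lambda>\<omega>. s ^ w I \<omega>)" for s :: real
  \<comment> \<open>The exponent uses truncated subtraction; where the count is 0 the factor in
    front makes the term vanish.\<close>
  define G' where "G' s = expectation (\<lambda>\<omega>. real (w I \<omega>) * s ^ (w I \<omega> - 1))" for s :: real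
  have G_deriv: "(G has_real_derivative G' s) (at s)" for s
  proof -
    have "G = (\<lambda>s. \<Sum>k\<le>card I. s ^ k * prob {\<omega>\<in>space M. w I \<omega> = k})"
      unfolding G_def using expand[of "\<lambda>k. _ ^ k"] by auto
    moreover have "G' s = (\<Sum>k\<le>card I. (real k * s ^ (k - 1)) * prob {\<omega>\<in>space M. w I \<omega> = k})"
      unfolding G'_def using expand[of "\<lambda>k. real k * s ^ (k-1)"] by auto
    ultimately show ?thesis by (auto intro!: derivative_eq_intros sum.cong)
  qed
  have sum_ind: "real (w I \<omega>) = (\<Sum>\<alpha>\<in>I. indicator (E \<alpha>) \<omega>)" for \<omega>
  proof -
    have "(\<Sum>\<alpha>\<in>I. indicat_real (E \<alpha>) \<omega>) = (\<Sum>\<alpha>\<in>I. of_bool (\<omega> \<in> E \<alpha>))" by (simp add: indicator_def)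
    also have "\<dots> = real (card {\<alpha>\<in>I. \<omega> \<in> E \<alpha>})" using fin by (simp add: Int_def)
    finally show ?thesis by (simp add: w_def)
  qed
  \<comment> \<open>For each \<open>\<alpha>\<close> three exchanges are made: on
    \<open>E \<alpha>\<close> the exponent \<open>w I - 1\<close> becomes
    \<open>w (I - N \<alpha>)\<close>, the expectation factorises, and then
    \<open>w (I - N \<alpha>)\<close> is turned back into \<open>w I\<close>. The first exchange
    costs the joint probabilities, the last one the products.\<close>
  have bound: "\<bar>G' s - lam * G s\<bar> \<le> ?B" if s: "0 \<le> s" "s \<le> 1" for s
  proof -
    have dia: "integrable M (\<lambda>\<omega>. indicat_real (E \<alpha>) \<omega> * s ^ (w I \<omega> - 1))" if "\<alpha> \<in> I" for \<alpha>
      using integrable_mult_indicator[OF E[OF that] pow1_int[OF subset_refl s]] by simp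
    have dib: "integrable M (\<lambda>\<omega>. indicat_real (E \<alpha>) \<omega> * s ^ w (I - N \<alpha>) \<omega>)" if "\<alpha> \<in> I" for \<alpha>
      using integrable_mult_indicator[OF E[OF that] pow_int[OF _ s, of "I - N \<alpha>"]] by auto
    have "G' s = (\<Sum>\<alpha>\<in>I. expectation (\<lambda>\<omega>. indicator (E \<alpha>) \<omega> * s ^ (w I \<omega> - 1)))"
      unfolding G'_def sum_ind sum_distrib_right
      by (rule Bochner_Integration.integral_sum) (rule dia)
    then have "G' s - lam * G s
        = (\<Sum>\<alpha>\<in>I. expectation (\<lambda>\<omega>. indicator (E \<alpha>) \<omega> * s ^ (w I \<omega> - 1)) - prob (E \<alpha>) * G s)"
      by (simp add: lam_def sum_subtractf sum_distrib_right)
    also have "\<bar>\<dots>\<bar> \<le> ?B"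
    proof (rule order_trans[OF sum_abs], rule sum_mono)
      fix \<alpha> assume a: "\<alpha> \<in> I"
      let ?V = "w (I - N \<alpha>)"
      have split: "w I \<omega> = ?V \<omega> + w (N \<alpha>) \<omega>" for \<omega>
      proof -
        have "{\<beta>\<in>I. \<omega> \<in> E \<beta>} = {\<beta>\<in>I - N \<alpha>. \<omega> \<in> E \<beta>} \<union> {\<beta>\<in>N \<alpha>. \<omega> \<in> E \<beta>}"
          using NI[OF a] by auto
        moreover have "finite {\<beta>\<in>N \<alpha>. \<omega> \<in> E \<beta>}" using fJ[OF NI[OF a]] by simp
        ultimately show ?thesis unfolding w_def using fin
          by (simp add: card_Un_disjoint disjoint_iff)
      qed
      have p01: "0 \<le> s ^ k" "s ^ k \<le> 1" for k using s by (auto intro: power_le_one)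
      have one_le: "1 \<le> (\<Sum>\<beta>\<in>J. indicat_real (E \<beta>) \<omega>)"
        if "\<gamma> \<in> J" "\<omega> \<in> E \<gamma>" "J \<subseteq> I" for J \<gamma> \<omega>
        using member_le_sum[of \<gamma> J "\<lambda>\<beta>. indicat_real (E \<beta>) \<omega>"] that fJ by auto
      have dist1: "\<bar>s ^ k - s ^ l\<bar> \<le> 1" for k l using p01[of k] p01[of l] by linarith
      \<comment> \<open>On \<open>E \<alpha>\<close> the subtracted 1 removes
        \<open>\<alpha>\<close> itself, so the exponents differ only if another event of
        \<open>N \<alpha>\<close> occurs; in that case the right side is at least 1, while powers of
        \<open>s\<close> are at most 1 apart.\<close>
      have pt1: "\<bar>indicator (E \<alpha>) \<omega> * s ^ (w I \<omega> - 1) - indicator (E \<alpha>) \<omega> * s ^ ?V \<omega>\<bar>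
          \<le> (\<Sum>\<beta>\<in>N \<alpha> - {\<alpha>}. indicat_real (E \<alpha> \<inter> E \<beta>) \<omega>)" for \<omega>
      proof (cases "\<omega> \<in> E \<alpha>")
        case True
        have eq: "(\<Sum>\<beta>\<in>N \<alpha> - {\<alpha>}. indicat_real (E \<alpha> \<inter> E \<beta>) \<omega>) = (\<Sum>\<beta>\<in>N \<alpha> - {\<alpha>}. indicat_real (E \<beta>) \<omega>)"
          using True by (auto intro!: sum.cong simp: indicator_def)
        show ?thesis
        proof (cases "\<exists>\<gamma>\<in>N \<alpha> - {\<alpha>}. \<omega> \<in> E \<gamma>")
          case True2: True
          then obtain \<gamma> where "\<gamma> \<in> N \<alpha> - {\<alpha>}" "\<omega> \<in> E \<gamma>" by blast
          from one_le[OF this] NI[OF a] have "1 \<le> (\<Sum>\<beta>\<in>N \<alpha> - {\<alpha>}. indicat_real (E \<beta>) \<omega>)" by blast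
          then show ?thesis using dist1[of "w I \<omega> - 1" "?V \<omega>"] True eq by simp
        next
          case False
          then have "{\<beta>\<in>N \<alpha>. \<omega> \<in> E \<beta>} = {\<alpha>}" using True Na[OF a] by auto
          then have "w (N \<alpha>) \<omega> = 1" by (simp add: w_def)
          then show ?thesis using split[of \<omega>] by (simp add: sum_nonneg)
        qed
      qed (simp add: sum_nonneg)
      have pt2: "\<bar>s ^ ?V \<omega> - s ^ w I \<omega>\<bar> \<le> (\<Sum>\<beta>\<in>N \<alpha>. indicat_real (E \<beta>) \<omega>)" for \<omega>
      proof (cases "\<exists>\<gamma>\<in>N \<alpha>. \<omega> \<in> E \<gamma>")
        case True
        then show ?thesis using one_le[of _ "N \<alpha>" \<omega>] NI[OF a] dist1[of "?V \<omega>" "w I \<omega>"] by fastforce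
      next
        case False
        then have "{\<beta>\<in>N \<alpha>. \<omega> \<in> E \<beta>} = {}" by auto
        then have "w (N \<alpha>) \<omega> = 0" by (simp only: w_def card.empty)
        then show ?thesis using split[of \<omega>] by (simp add: sum_nonneg)
      qed
      have EI: "E \<alpha> \<inter> E \<beta> \<in> events" if "\<beta> \<in> N \<alpha>" for \<beta> using E[OF a] E that NI[OF a] by blast
      have "\<bar>expectation (\<lambda>\<omega>. indicator (E \<alpha>) \<omega> * s ^ (w I \<omega> - 1))
             - expectation (\<lambda>\<omega>. indicator (E \<alpha>) \<omega> * s ^ ?V \<omega>)\<bar>
           \<le> expectation (\<lambda>\<omega>. \<Sum>\<beta>\<in>N \<alpha> - {\<alpha>}. indicat_real (E \<alpha> \<inter> E \<beta>) \<omega>)"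
      proof (subst Bochner_Integration.integral_diff[symmetric, OF dia[OF a] dib[OF a]],
             rule order_trans[OF integral_abs_bound], rule integral_mono)
        show "integrable M (\<lambda>\<omega>. \<Sum>\<beta>\<in>N \<alpha> - {\<alpha>}. indicat_real (E \<alpha> \<inter> E \<beta>) \<omega>)"
          using EI by (intro Bochner_Integration.integrable_sum) (auto simp: integrable_real_indicator emeasure_eq_measure)
        show "integrable M (\<lambda>\<omega>. \<bar>indicat_real (E \<alpha>) \<omega> * s ^ (w I \<omega> - 1) - indicat_real (E \<alpha>) \<omega> * s ^ ?V \<omega>\<bar>)"
          by (intro integrable_abs Bochner_Integration.integrable_diff dia dib a)
      qed (use pt1 in auto)
      also have "\<dots> = (\<Sum>\<beta>\<in>N \<alpha> - {\<alpha>}. prob (E \<alpha> \<inter> E \<beta>))"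
        using EI by (subst Bochner_Integration.integral_sum) (auto simp: integrable_real_indicator emeasure_eq_measure)
      finally have 1: "\<bar>expectation (\<lambda>\<omega>. indicator (E \<alpha>) \<omega> * s ^ (w I \<omega> - 1))
             - expectation (\<lambda>\<omega>. indicator (E \<alpha>) \<omega> * s ^ ?V \<omega>)\<bar> \<le> (\<Sum>\<beta>\<in>N \<alpha> - {\<alpha>}. prob (E \<alpha> \<inter> E \<beta>))" .
      have "\<bar>expectation (\<lambda>\<omega>. s ^ ?V \<omega>) - G s\<bar> \<le> expectation (\<lambda>\<omega>. \<Sum>\<beta>\<in>N \<alpha>. indicat_real (E \<beta>) \<omega>)"
        unfolding G_def
      proof (subst Bochner_Integration.integral_diff[symmetric],
             goal_cases)
        case 3
        show ?case
          by (rule order_trans[OF integral_abs_bound], rule integral_mono)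
             (use NI[OF a] pt2 s in \<open>auto intro!: integrable_abs Bochner_Integration.integrable_diff
                Bochner_Integration.integrable_sum pow_int ind_int\<close>)
      qed (use s in \<open>auto intro!: pow_int\<close>)
      also have "\<dots> = (\<Sum>\<beta>\<in>N \<alpha>. prob (E \<beta>))"
        using NI[OF a] E by (subst Bochner_Integration.integral_sum) (auto intro!: ind_int sum.cong)
      finally have 2: "\<bar>expectation (\<lambda>\<omega>. s ^ ?V \<omega>) - G s\<bar> \<le> (\<Sum>\<beta>\<in>N \<alpha>. prob (E \<beta>))" .
      have "\<bar>prob (E \<alpha>) * expectation (\<lambda>\<omega>. s ^ ?V \<omega>) - prob (E \<alpha>) * G s\<bar>
          = prob (E \<alpha>) * \<bar>expectation (\<lambda>\<omega>. s ^ ?V \<omega>) - G s\<bar>"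
        by (simp add: abs_mult flip: right_diff_distrib)
      also have "\<dots> \<le> prob (E \<alpha>) * (\<Sum>\<beta>\<in>N \<alpha>. prob (E \<beta>))" using 2 by (intro mult_left_mono) auto
      finally show "\<bar>expectation (\<lambda>\<omega>. indicator (E \<alpha>) \<omega> * s ^ (w I \<omega> - 1)) - prob (E \<alpha>) * G s\<bar>
          \<le> (\<Sum>\<beta>\<in>N \<alpha>. prob (E \<alpha>) * prob (E \<beta>)) + (\<Sum>\<beta>\<in>N \<alpha> - {\<alpha>}. prob (E \<alpha> \<inter> E \<beta>))"
        using 1 indep[OF a s] by (simp add: sum_distrib_left)
    qed
    finally show ?thesis .
  qed
  \<comment> \<open>Integrating factor for \<open>G' = lam * G\<close>: by the mean value theorem
    the defect of the differential equation bounds \<open>h 1 - h 0\<close>, and these end values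
    are the two quantities to be compared.\<close>
  define h where "h s = G s * exp (- (lam * s))" for s
  have h_deriv: "(h has_real_derivative (G' s - lam * G s) * exp (- (lam * s))) (at s)" for s
    unfolding h_def by (auto intro!: derivative_eq_intros G_deriv simp: algebra_simps)
  obtain z where z: "0 < z" "z < 1" and hz: "h 1 - h 0 = (1 - 0) * ((G' z - lam * G z) * exp (- (lam * z)))"
    using MVT2[of 0 1 h "\<lambda>s. (G' s - lam * G s) * exp (- (lam * s))"] h_deriv by auto
  have "\<bar>h 1 - h 0\<bar> = \<bar>G' z - lam * G z\<bar> * exp (- (lam * z))" by (simp add: hz abs_mult)
  also have "\<dots> \<le> \<bar>G' z - lam * G z\<bar> * 1" using lam0 z by (intro mult_left_mono) auto
  also have "\<dots> \<le> ?B" using bound[of z] z by simp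
  finally have main: "\<bar>h 1 - h 0\<bar> \<le> ?B" .
  have "h 1 = exp (- lam)" by (simp add: h_def G_def prob_space)
  \<comment> \<open>At \<open>s = 0\<close> the convention \<open>0 ^ 0 = 1\<close> turns
    \<open>s ^ w I\<close> into the indicator that the count is 0.\<close>
  moreover have "h 0 = prob {\<omega>\<in>space M. \<forall>\<alpha>\<in>I. \<omega> \<notin> E \<alpha>}"
  proof -
    have set_eq: "{\<omega>\<in>space M. w I \<omega> = 0} = {\<omega>\<in>space M. \<forall>\<alpha>\<in>I. \<omega> \<notin> E \<alpha>}"
      using fin by (auto simp: w_def)
    have "h 0 = expectation (\<lambda>\<omega>. indicat_real {\<omega>\<in>space M. w I \<omega> = 0} \<omega>)"
      unfolding h_def G_def
      by (auto intro!: Bochner_Integration.integral_cong simp: indicator_def power_0_left)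
    also have "\<dots> = prob {\<omega>\<in>space M. w I \<omega> = 0}" using lev[of 0] by (simp add: emeasure_eq_measure)
    finally show ?thesis unfolding set_eq .
  qed
  ultimately show ?thesis using main by (simp add: lam_def abs_minus_commute)
qed

section \<open>Perimeters of inscribed triangles\<close>

text \<open>The distance of \<open>sin (pi / 3 + h)\<close> below the tangent line of the sine at
  \<open>pi / 3\<close>. The first summand is even and carries the quadratic term, the second is odd
  and of third order.\<close>

definition side_defect :: "real \<Rightarrow> real" where
  "side_defect h = sqrt 3 / 2 * (1 - cos h) + (h - sin h) / 2"

lemma sin_third_add: "sin (pi / 3 + h) = sqrt 3 / 2 + h / 2 - side_defect h"
  unfolding sin_add sin_60 cos_60 side_defect_def by (simp add: field_simps)

lemma abs_sin_minus_self_le: "\<bar>sin h - h\<bar> \<le> \<bar>h\<bar> ^ 3 / 6" for h :: real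
  using Maclaurin_sin_bound[of h 3]
  by (simp add: numeral_eq_Suc sin_coeff_def fact_numeral field_simps)

text \<open>Half-angle formula: the left side is a difference of the squares of
  \<open>sin (h / 2)\<close> and \<open>h / 2\<close>, so the cubic bound for the sine, times the
  sum of the two, gives fourth order.\<close>

lemma abs_cos_defect_le: "\<bar>1 - cos h - h\<^sup>2 / 2\<bar> \<le> h ^ 4 / 24" for h :: real
proof -
  let ?k = "h / 2"
  have "1 - cos h - h\<^sup>2 / 2 = 2 * (sin ?k - ?k) * (sin ?k + ?k)"
    using cos_double_sin[of ?k] by (simp add: power2_eq_square algebra_simps)
  then have "\<bar>1 - cos h - h\<^sup>2 / 2\<bar> = 2 * \<bar>sin ?k - ?k\<bar> * \<bar>sin ?k + ?k\<bar>" by (simp only: abs_mult abs_numeral)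
  also have "\<dots> \<le> 2 * (\<bar>?k\<bar> ^ 3 / 6) * (2 * \<bar>?k\<bar>)"
    using abs_sin_minus_self_le[of ?k] abs_sin_x_le_abs_x[of ?k]
    by (intro mult_mono) auto
  also have "\<dots> = \<bar>h\<bar> ^ 4 / 24" by (simp add: power_divide numeral_eq_Suc)
  finally show ?thesis by simp
qed

lemma pi_less_63_20: "pi < 63 / 20"
  using pi_approx by simp

lemma sqrt3_bounds: "173 / 100 < sqrt 3" "sqrt 3 < 174 / 100"
  by (rule real_less_rsqrt real_less_lsqrt; simp add: power2_eq_square)+

text \<open>The quartic error of the cosine is absorbed into a cubic one because \<open>h\<close> is
  bounded. The range is the one in which half central angles can deviate from
  \<open>pi / 3\<close>.\<close>

lemma side_defect_approx:
  assumes "\<bar>h\<bar> \<le> 2 * pi / 3"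
  shows "\<bar>side_defect h - sqrt 3 / 4 * h\<^sup>2\<bar> \<le> \<bar>h\<bar> ^ 3 / 6"
proof -
  have h: "\<bar>h\<bar> \<le> 21 / 10" using assms pi_less_63_20 by linarith
  have "side_defect h - sqrt 3 / 4 * h\<^sup>2 = sqrt 3 / 2 * (1 - cos h - h\<^sup>2 / 2) + (h - sin h) / 2"
    by (simp add: side_defect_def field_simps)
  also have "\<bar>\<dots>\<bar> \<le> sqrt 3 / 2 * \<bar>1 - cos h - h\<^sup>2 / 2\<bar> + \<bar>sin h - h\<bar> / 2"
    by (rule order_trans[OF abs_triangle_ineq]) (simp add: abs_mult)
  also have "\<dots> \<le> 174 / 200 * (h ^ 4 / 24) + (\<bar>h\<bar> ^ 3 / 6) / 2"
    using abs_cos_defect_le abs_sin_minus_self_le sqrt3_bounds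
    by (intro add_mono mult_mono divide_right_mono) auto
  also have "h ^ 4 = \<bar>h\<bar> ^ 3 * \<bar>h\<bar>" by (simp add: numeral_eq_Suc)
  also have "174 / 200 * (\<bar>h\<bar> ^ 3 * \<bar>h\<bar> / 24) \<le> 174 / 200 * (\<bar>h\<bar> ^ 3 * (21 / 10) / 24)"
    using h by (intro mult_left_mono divide_right_mono) auto
  finally have "\<bar>side_defect h - sqrt 3 / 4 * h\<^sup>2\<bar> \<le> 3827 / 24000 * \<bar>h\<bar> ^ 3" by simp
  moreover have "3827 / 24000 * \<bar>h\<bar> ^ 3 \<le> \<bar>h\<bar> ^ 3 / 6" by simp
  ultimately show ?thesis by linarith
qed

text \<open>Coercivity on the whole range: the quadratic coefficient exceeds 0.43, the cubic
  remainder is at most 0.35 times the square, and 0.08 is more than 1/16.\<close>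

lemma side_defect_ge:
  assumes "\<bar>h\<bar> \<le> 2 * pi / 3"
  shows "h\<^sup>2 / 16 \<le> side_defect h"
proof -
  have h: "\<bar>h\<bar> \<le> 21 / 10" using assms pi_less_63_20 by linarith
  have "\<bar>h\<bar> ^ 3 = h\<^sup>2 * \<bar>h\<bar>" by (simp add: power3_eq_cube power2_eq_square)
  also have "\<dots> \<le> h\<^sup>2 * (21 / 10)" using h by (intro mult_left_mono) auto
  finally have "\<bar>h\<bar> ^ 3 / 6 \<le> 35 / 100 * h\<^sup>2" by simp
  moreover have "43 / 100 * h\<^sup>2 \<le> sqrt 3 / 4 * h\<^sup>2" using sqrt3_bounds by (intro mult_right_mono) auto
  ultimately show ?thesis using side_defect_approx[OF assms] zero_le_power2[of h] by linarith
qed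

section \<open>Chords and perimeters in terms of angles\<close>

lemma norm_circle_point_diff: "norm (circle_point a - circle_point b) = 2 * \<bar>sin ((a - b) / 2)\<bar>"
proof -
  have "(norm (circle_point a - circle_point b))\<^sup>2 = (cos a - cos b)\<^sup>2 + (sin a - sin b)\<^sup>2"
    by (simp add: circle_point_def norm_vec_def L2_set_def sum_2)
  also have "\<dots> = ((cos a)\<^sup>2 + (sin a)\<^sup>2) + ((cos b)\<^sup>2 + (sin b)\<^sup>2) - 2 * (cos a * cos b + sin a * sin b)"
    by (simp add: power2_diff algebra_simps)
  also have "\<dots> = 2 - 2 * cos (a - b)" by (simp add: cos_diff)
  also have "cos (a - b) = 1 - 2 * (sin ((a - b) / 2))\<^sup>2"
    using cos_double_sin[of "(a - b) / 2"] by (simp only: mult_2 field_sum_of_halves)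
  also have "2 - 2 * (1 - 2 * (sin ((a - b) / 2))\<^sup>2) = (2 * sin ((a - b) / 2))\<^sup>2"
    by (simp add: power2_eq_square)
  finally have "norm (circle_point a - circle_point b) = sqrt ((2 * sin ((a - b) / 2))\<^sup>2)"
    by (metis norm_ge_zero real_sqrt_unique)
  then show ?thesis by (simp only: real_sqrt_abs abs_mult abs_numeral)
qed

lemma peri_circle_point:
  "peri (circle_point a) (circle_point b) (circle_point c)
    = 2 * \<bar>sin ((b - a) / 2)\<bar> + 2 * \<bar>sin ((c - b) / 2)\<bar> + 2 * \<bar>sin ((c - a) / 2)\<bar>"
proof -
  have "\<bar>sin ((x - y) / 2)\<bar> = \<bar>sin ((y - x) / 2)\<bar>" for x y :: real
    using sin_minus[of "(x - y) / 2"] by (simp only: minus_divide_left minus_diff_eq abs_minus_cancel)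
  then show ?thesis unfolding peri_def norm_circle_point_diff by metis
qed

lemma peri_rotate: "peri x y z = peri y z x"
  by (simp add: peri_def)

lemma peri_swap: "peri x y z = peri x z y"
  by (simp add: peri_def norm_minus_commute)

text \<open>For offsets \<open>u\<close>, \<open>v\<close> of the two free vertices from the angles
  \<open>2 * pi / 3\<close> and \<open>4 * pi / 3\<close>, this is twice the sum of the squared
  deviations of the three half central angles. Its sublevel sets are ellipses.\<close>

definition eqform :: "real \<Rightarrow> real \<Rightarrow> real" where
  "eqform u v = u\<^sup>2 - u * v + v\<^sup>2"

text \<open>A triangle rotated so that one vertex has angle 0, the other two being listed in cyclic
  order.\<close>

context
  fixes b c :: real
  assumes bc: "0 \<le> b" "b \<le> c" "c \<le> 2 * pi"
begin

text \<open>
  Deviations from \<open>pi / 3\<close> of the three half central angles. They sum to zero, so the linear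
  terms of the side lengths cancel in the perimeter.
\<close>

definition dev1 where "dev1 = b / 2 - pi / 3"
definition dev2 where "dev2 = (c - b) / 2 - pi / 3"
definition dev3 where "dev3 = 2 * pi / 3 - c / 2"
lemmas dev_defs = dev1_def dev2_def dev3_def

lemma dev_range: "\<bar>dev1\<bar> \<le> 2 * pi / 3" "\<bar>dev2\<bar> \<le> 2 * pi / 3" "\<bar>dev3\<bar> \<le> 2 * pi / 3"
  using bc pi_gt_zero unfolding dev_defs abs_le_iff by (auto simp: field_simps)

lemma dev_squares: "dev1\<^sup>2 + dev2\<^sup>2 + dev3\<^sup>2 = eqform (b - 2 * pi / 3) (c - 4 * pi / 3) / 2"
  unfolding dev_defs eqform_def by (simp add: power2_eq_square field_simps)

lemma sides:
  "norm (circle_point 0 - circle_point b) = sqrt 3 + dev1 - 2 * side_defect dev1"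
  "norm (circle_point b - circle_point c) = sqrt 3 + dev2 - 2 * side_defect dev2"
  "norm (circle_point 0 - circle_point c) = sqrt 3 + dev3 - 2 * side_defect dev3"
proof -
  have *: "2 * \<bar>sin x\<bar> = sqrt 3 + h - 2 * side_defect h"
    if "0 \<le> x" "x \<le> pi" "sin x = sin (pi / 3 + h)" for x h
    using that sin_ge_zero[of x] by (simp add: sin_third_add)
  have n: "\<bar>sin ((0 - x) / 2)\<bar> = \<bar>sin (x / 2)\<bar>" "\<bar>sin ((b - c) / 2)\<bar> = \<bar>sin ((c - b) / 2)\<bar>" for x :: real
    using sin_minus[of "x / 2"] sin_minus[of "(b - c) / 2"] minus_diff_eq[of b c] minus_divide_left[of "b - c" 2]
    by (metis diff_0 minus_divide_left abs_minus_cancel)+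
  show "norm (circle_point 0 - circle_point b) = sqrt 3 + dev1 - 2 * side_defect dev1"
    unfolding norm_circle_point_diff n by (rule *) (use bc in \<open>auto simp: dev_defs\<close>)
  show "norm (circle_point b - circle_point c) = sqrt 3 + dev2 - 2 * side_defect dev2"
    unfolding norm_circle_point_diff n by (rule *) (use bc in \<open>auto simp: dev_defs\<close>)
  \<comment> \<open>The third arc runs from \<open>c\<close> on to \<open>2 * pi\<close>; half of it
    is \<open>pi - c / 2\<close>, which has the same sine as \<open>c / 2\<close>.\<close>
  have "pi / 3 + dev3 = pi - c / 2" by (simp add: dev_defs)
  then show "norm (circle_point 0 - circle_point c) = sqrt 3 + dev3 - 2 * side_defect dev3"
    unfolding norm_circle_point_diff n by (intro *) (use bc sin_pi_minus[of "c / 2"] in auto)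
qed

lemma peri_defect:
  "3 * sqrt 3 - peri (circle_point 0) (circle_point b) (circle_point c)
     = 2 * (side_defect dev1 + side_defect dev2 + side_defect dev3)"
proof -
  have "dev1 + dev2 + dev3 = 0" by (simp add: dev_defs field_simps)
  moreover have "norm (circle_point c - circle_point 0) = norm (circle_point 0 - circle_point c)"
    by (rule norm_minus_commute)
  ultimately show ?thesis unfolding peri_def using sides by simp
qed

text \<open>A crude bound valid for every inscribed triangle. It confines triangles of small defect
  to a small ellipse, where the sharp approximation becomes available.\<close>

lemma peri_defect_ge:
  "eqform (b - 2 * pi / 3) (c - 4 * pi / 3) / 16
     \<le> 3 * sqrt 3 - peri (circle_point 0) (circle_point b) (circle_point c)"
  using side_defect_ge[OF dev_range(1)] side_defect_ge[OF dev_range(2)] side_defect_ge[OF dev_range(3)]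
  unfolding peri_defect using dev_squares by simp

lemma dev_abs_le:
  assumes "eqform (b - 2 * pi / 3) (c - 4 * pi / 3) \<le> 2 * s\<^sup>2" "0 \<le> s"
  shows "\<bar>dev1\<bar> \<le> s" "\<bar>dev2\<bar> \<le> s" "\<bar>dev3\<bar> \<le> s"
proof -
  have *: "dev1\<^sup>2 + dev2\<^sup>2 + dev3\<^sup>2 \<le> s\<^sup>2" using dev_squares assms by simp
  have "dev1\<^sup>2 \<le> s\<^sup>2" "dev2\<^sup>2 \<le> s\<^sup>2" "dev3\<^sup>2 \<le> s\<^sup>2"
    using * zero_le_power2[of dev1] zero_le_power2[of dev2] zero_le_power2[of dev3] by linarith+
  then show "\<bar>dev1\<bar> \<le> s" "\<bar>dev2\<bar> \<le> s" "\<bar>dev3\<bar> \<le> s"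
    using assms(2) by (auto simp: power2_le_iff_abs_le)
qed

text \<open>With all deviations at most \<open>s\<close>, the cubic remainder is at most
  \<open>s / 6\<close> times the square. The error is thus a multiple of the form itself, which
  later traps the sublevel sets of the defect between concentric ellipses.\<close>

lemma peri_defect_approx:
  assumes Q: "eqform (b - 2 * pi / 3) (c - 4 * pi / 3) \<le> 2 * s\<^sup>2" "0 \<le> s"
  shows "\<bar>3 * sqrt 3 - peri (circle_point 0) (circle_point b) (circle_point c)
            - sqrt 3 / 4 * eqform (b - 2 * pi / 3) (c - 4 * pi / 3)\<bar>
         \<le> s / 6 * eqform (b - 2 * pi / 3) (c - 4 * pi / 3)"
proof -
  let ?d = "\<lambda>h. side_defect h - sqrt 3 / 4 * h\<^sup>2"
  have cub: "\<bar>?d h\<bar> \<le> s / 6 * h\<^sup>2" if "\<bar>h\<bar> \<le> s" "\<bar>h\<bar> \<le> 2 * pi / 3" for h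
  proof -
    have "\<bar>h\<bar> ^ 3 = \<bar>h\<bar> * h\<^sup>2" by (simp add: power3_eq_cube power2_eq_square)
    also have "\<dots> \<le> s * h\<^sup>2" using that by (intro mult_right_mono) auto
    finally show ?thesis using side_defect_approx[OF that(2)] by simp
  qed
  have Q2: "eqform (b - 2 * pi / 3) (c - 4 * pi / 3) = 2 * (dev1\<^sup>2 + dev2\<^sup>2 + dev3\<^sup>2)"
    using dev_squares by simp
  have "\<bar>2 * (x + y + z) - k * (2 * (p + q + r))\<bar> \<le> l * (2 * (p + q + r))"
    if "\<bar>x - k * p\<bar> \<le> l * p" "\<bar>y - k * q\<bar> \<le> l * q" "\<bar>z - k * r\<bar> \<le> l * r" for x y z k l p q r :: real
    using that by (simp add: abs_le_iff algebra_simps)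
  from this[OF cub[OF dev_abs_le(1)[OF Q] dev_range(1)] cub[OF dev_abs_le(2)[OF Q] dev_range(2)]
      cub[OF dev_abs_le(3)[OF Q] dev_range(3)]]
  show ?thesis unfolding peri_defect Q2 .
qed

lemma near_equilateral_sides_aux:
  assumes "3 * sqrt 3 - peri (circle_point 0) (circle_point b) (circle_point c) \<le> e"
  shows "\<bar>norm (circle_point 0 - circle_point b) - sqrt 3\<bar> \<le> 6 * sqrt e"
    and "\<bar>norm (circle_point 0 - circle_point c) - sqrt 3\<bar> \<le> 6 * sqrt e"
proof -
  have Q: "eqform (b - 2 * pi / 3) (c - 4 * pi / 3) \<le> 16 * e" using peri_defect_ge assms by simp
  have "0 \<le> eqform (b - 2 * pi / 3) (c - 4 * pi / 3)"
    using dev_squares zero_le_power2[of dev1] zero_le_power2[of dev2] zero_le_power2[of dev3] by linarith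
  then have e: "0 \<le> e" using Q by linarith
  \<comment> \<open>Since 16 is at most 2 times 9, all deviations are at most
    \<open>3 * sqrt e\<close>; chords change at most twice as fast as half angles, whence the
    constant 6.\<close>
  have "eqform (b - 2 * pi / 3) (c - 4 * pi / 3) \<le> 2 * (3 * sqrt e)\<^sup>2"
    using Q e by (simp add: power_mult_distrib)
  note h = dev_abs_le[OF this]
  have *: "\<bar>h - 2 * side_defect h\<bar> \<le> 2 * \<bar>h\<bar>" for h
  proof -
    have "\<bar>sin (pi / 3 + h) - sin (pi / 3)\<bar> = \<bar>2 * sin (h / 2) * cos (pi / 3 + h / 2)\<bar>"
      by (simp add: sin_diff_sin field_simps)
    also have "\<dots> \<le> 2 * \<bar>h / 2\<bar> * 1"
      unfolding abs_mult using abs_sin_x_le_abs_x[of "h / 2"] by (intro mult_mono) auto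
    finally show ?thesis unfolding sin_third_add by (simp add: sin_60)
  qed
  show "\<bar>norm (circle_point 0 - circle_point b) - sqrt 3\<bar> \<le> 6 * sqrt e"
    using *[of dev1] h(1) e unfolding sides by simp
  show "\<bar>norm (circle_point 0 - circle_point c) - sqrt 3\<bar> \<le> 6 * sqrt e"
    using *[of dev3] h(3) e unfolding sides by simp
qed

end

section \<open>From side lengths back to positions on the circle\<close>

lemma circle_point_onto:
  assumes "norm p = 1"
  obtains \<theta> where "\<theta> \<in> {0..2*pi}" "p = circle_point (a + \<theta>)"
proof -
  have "(p $ 1)\<^sup>2 + (p $ 2)\<^sup>2 = 1" using assms by (simp add: norm_vec_def L2_set_def sum_2)
  then have "(p $ 1 * cos a + p $ 2 * sin a)\<^sup>2 + (p $ 2 * cos a - p $ 1 * sin a)\<^sup>2 = 1"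
    using sin_cos_squared_add[of a] by algebra
  then obtain \<theta> where \<theta>: "0 \<le> \<theta>" "\<theta> < 2 * pi" "p $ 1 * cos a + p $ 2 * sin a = cos \<theta>"
      "p $ 2 * cos a - p $ 1 * sin a = sin \<theta>" by (metis sincos_total_2pi)
  have "cos (a + \<theta>) = p $ 1 * ((cos a)\<^sup>2 + (sin a)\<^sup>2)"
    unfolding cos_add \<theta>(3,4)[symmetric] by (simp only: power2_eq_square) algebra
  moreover have "sin (a + \<theta>) = p $ 2 * ((cos a)\<^sup>2 + (sin a)\<^sup>2)"
    unfolding sin_add \<theta>(3,4)[symmetric] by (simp only: power2_eq_square) algebra
  ultimately have "p = circle_point (a + \<theta>)"
    by (simp add: vec_eq_iff forall_2 circle_point_def)
  with \<theta>(1,2) show ?thesis using that[of \<theta>] by auto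
qed

text \<open>Rotate \<open>x\<close> to angle 0. According to the order of the other two angles, the
  side from \<open>x\<close> to \<open>y\<close> is the first or the last chord of the ordered
  configuration, which is why both were estimated.\<close>

lemma near_equilateral_triangle_side:
  assumes "norm x = 1" "norm y = 1" "norm z = 1" and D: "3 * sqrt 3 - peri x y z \<le> e"
  shows "\<bar>norm (x - y) - sqrt 3\<bar> \<le> 6 * sqrt e"
proof -
  obtain a where x: "x = circle_point a" using circle_point_onto[OF assms(1), of 0] by auto
  obtain b where b: "b \<in> {0..2*pi}" and y: "y = circle_point (a + b)" using circle_point_onto[OF assms(2)] .
  obtain c where c: "c \<in> {0..2*pi}" and z: "z = circle_point (a + c)" using circle_point_onto[OF assms(3)] .
  have P: "peri x y z = peri (circle_point 0) (circle_point b) (circle_point c)"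
    by (simp add: x y z peri_circle_point)
  have N: "norm (x - y) = norm (circle_point 0 - circle_point b)"
    by (simp add: x y norm_circle_point_diff)
  show ?thesis
  proof (cases "b \<le> c")
    case True
    then show ?thesis unfolding N using near_equilateral_sides_aux(1)[of b c e] b c D P by simp
  next
    case False
    then show ?thesis unfolding N using near_equilateral_sides_aux(2)[of c b e] b c D P peri_swap by simp
  qed
qed

text \<open>Inverts the chord length: exactly two angles give a chord \<open>sqrt 3\<close>, and on
  each half circle the chord responds to the half angle with slope at least 2/5 as seen from
  \<open>pi / 3\<close>. Passing to full angles gives the factor 5.\<close>

lemma side_near_sqrt3_angle:
  assumes b: "b \<in> {0..2*pi}" and d: "\<bar>norm (circle_point 0 - circle_point b) - sqrt 3\<bar> \<le> d"
  shows "\<bar>b - 2 * pi / 3\<bar> \<le> 5 * d \<or> \<bar>b - 4 * pi / 3\<bar> \<le> 5 * d"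
proof -
  have half: "\<bar>2 * x - 2 * pi / 3\<bar> \<le> 5 * d" if x: "0 \<le> x" "x \<le> pi / 2" "\<bar>2 * sin x - sqrt 3\<bar> \<le> d" for x
  proof -
    define h where "h = x - pi / 3"
    have hr: "- (pi / 3) \<le> h" "h \<le> pi / 6" using x by (auto simp: h_def)
    then have habs: "\<bar>h\<bar> \<le> 2 * pi / 3" by (simp add: abs_le_iff)
    have s: "2 * sin x - sqrt 3 = h - 2 * side_defect h"
      using sin_third_add[of h] by (simp add: h_def)
    have "2 / 5 * \<bar>h\<bar> \<le> \<bar>h - 2 * side_defect h\<bar>"
    proof (cases "h \<le> 0")
      case True
      have "0 \<le> side_defect h" using side_defect_ge[OF habs] zero_le_power2[of h] by linarith
      with True show ?thesis by simp
    next
      case False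
      \<comment> \<open>Here \<open>h\<close> is at most \<open>pi / 6\<close>. With this bound the
        defect is below 0.3 times \<open>h\<close>, so at least 2/5 of the linear term
        survives.\<close>
      have h: "h \<le> (525 / 1000)" using hr pi_less_63_20 by simp
      have "side_defect h \<le> sqrt 3 / 4 * h\<^sup>2 + h ^ 3 / 6" using side_defect_approx[OF habs] False
        by (simp only: abs_le_iff abs_of_pos not_le) linarith
      also have "sqrt 3 / 4 * h\<^sup>2 \<le> 174 / 400 * ((525 / 1000) * h)"
        using h False sqrt3_bounds unfolding power2_eq_square by (intro mult_mono) auto
      also have "h ^ 3 \<le> (525 / 1000) * (525 / 1000) * h"
        using h False unfolding power3_eq_cube by (intro mult_mono) auto
      finally show ?thesis using False by simp
    qed
    with x(3) s have "2 * \<bar>h\<bar> \<le> 5 * d" by simp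
    moreover have "2 * x - 2 * pi / 3 = 2 * h" by (simp add: h_def)
    ultimately show ?thesis by (simp only: abs_mult abs_numeral)
  qed
  have e: "norm (circle_point 0 - circle_point b) = 2 * sin (b / 2)"
    unfolding norm_circle_point_diff using sin_ge_zero[of "b / 2"] b by simp
  show ?thesis
  proof (cases "b \<le> pi")
    case True
    then show ?thesis using half[of "b / 2"] b d e by simp
  next
    case False
    \<comment> \<open>Reflection: the angles \<open>b\<close> and \<open>2 * pi - b\<close> have the
      same chord.\<close>
    have "\<bar>2 * (pi - b / 2) - 2 * pi / 3\<bar> \<le> 5 * d"
      using half[of "pi - b / 2"] False b d e by simp
    then show ?thesis by (auto simp: abs_le_iff field_simps)
  qed
qed

section \<open>Probability of a nearly equilateral triangle\<close>

text \<open>Offsets below 1 are smaller than \<open>2 * pi / 3\<close>, so the ellipses stay away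
  from the lines where two vertices coincide and the cyclic order of the vertices is fixed on
  them.\<close>

lemma eqform_bounds:
  assumes "eqform u v \<le> 16 * e" "e \<le> 1 / 100"
  shows "\<bar>u\<bar> < 1" "\<bar>v\<bar> < 1" "\<bar>v - u\<bar> < 1"
proof -
  have *: "u\<^sup>2 + v\<^sup>2 + (v - u)\<^sup>2 = 2 * eqform u v"
    by (simp add: eqform_def power2_eq_square algebra_simps)
  then have "u\<^sup>2 < 1\<^sup>2" "v\<^sup>2 < 1\<^sup>2" "(v - u)\<^sup>2 < 1\<^sup>2"
    using assms zero_le_power2[of u] zero_le_power2[of v] zero_le_power2[of "v - u"] by (simp; linarith)+
  then show "\<bar>u\<bar> < 1" "\<bar>v\<bar> < 1" "\<bar>v - u\<bar> < 1"
    by (simp_all add: abs_square_less_1)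
qed

text \<open>Also true for negative \<open>s\<close>: the real square root is odd and
  \<open>ennreal\<close> sends negative numbers to 0. Slices can thus be integrated over the whole
  line without case distinction.\<close>

lemma emeasure_square_le: "emeasure lborel {x::real. (x - m)\<^sup>2 \<le> s} = ennreal (2 * sqrt s)"
proof (cases "0 \<le> s")
  case True
  have "{x. (x - m)\<^sup>2 \<le> s} = {m - sqrt s .. m + sqrt s}"
  proof -
    have "(x - m)\<^sup>2 \<le> s \<longleftrightarrow> \<bar>x - m\<bar> \<le> sqrt s" for x
      using real_sqrt_le_iff[of "(x - m)\<^sup>2" s] by (simp only: real_sqrt_abs)
    then have "(x - m)\<^sup>2 \<le> s \<longleftrightarrow> x \<in> {m - sqrt s .. m + sqrt s}" for x
      unfolding abs_le_iff atLeastAtMost_iff by (smt (verit))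
    then show ?thesis by blast
  qed
  then show ?thesis using True by simp
next
  case False
  have "\<not> (x - m)\<^sup>2 \<le> s" for x using zero_le_power2[of "x - m"] False by linarith
  then have "{x. (x - m)\<^sup>2 \<le> s} = {}" by simp
  then show ?thesis using False by (simp add: ennreal_neg)
qed

text \<open>Cavalieri: completing the square gives the slices of the ellipse, and rescaling the
  second coordinate by \<open>2 / sqrt 3\<close> turns their lengths into those of a disc of radius
  \<open>sqrt r\<close>.\<close>

lemma emeasure_ellipse:
  assumes r: "0 \<le> r"
  shows "emeasure lborel {z :: real \<times> real. eqform (fst z - p) (snd z - q) \<le> r} = ennreal (2 * pi * r / sqrt 3)"
proof -
  have slices: "emeasure lborel A = (\<integral>\<^sup>+ y. emeasure lborel {x. (x, y) \<in> A} \<partial>lborel)"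
    if "A \<in> sets borel" for A :: "(real \<times> real) set"
  proof -
    have "A \<in> sets (lborel \<Otimes>\<^sub>M lborel)" using that unfolding lborel_prod by simp
    from lborel_pair.emeasure_pair_measure_alt2[OF this]
    show ?thesis by (simp add: lborel_prod vimage_def)
  qed
  let ?E = "{z :: real \<times> real. eqform (fst z - p) (snd z - q) \<le> r}"
  have "continuous_on UNIV (\<lambda>z::real \<times> real. eqform (fst z - p) (snd z - q))"
    unfolding eqform_def by (intro continuous_intros)
  then have "?E \<in> sets borel"
    by (intro borel_closed closed_Collect_le) auto
  then have "emeasure lborel ?E = (\<integral>\<^sup>+ c. emeasure lborel {b. (b, c) \<in> ?E} \<partial>lborel)"
    by (rule slices)
  also have "\<dots> = (\<integral>\<^sup>+ c. ennreal (2 * sqrt (r - 3 / 4 * (c - q)\<^sup>2)) \<partial>lborel)"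
  proof (rule nn_integral_cong)
    fix c
    have "{b. (b, c) \<in> ?E} = {b. (b - (p + (c - q) / 2))\<^sup>2 \<le> r - 3 / 4 * (c - q)\<^sup>2}"
      unfolding eqform_def by (auto simp: power2_eq_square field_simps)
    then show "emeasure lborel {b. (b, c) \<in> ?E} = ennreal (2 * sqrt (r - 3 / 4 * (c - q)\<^sup>2))"
      by (simp only: emeasure_square_le)
  qed
  also have "\<dots> = ennreal \<bar>2 / sqrt 3\<bar> * (\<integral>\<^sup>+ y. ennreal (2 * sqrt (r - 3 / 4 * (q + 2 / sqrt 3 * y - q)\<^sup>2)) \<partial>lborel)"
    by (rule nn_integral_real_affine) auto
  also have "(\<integral>\<^sup>+ y. ennreal (2 * sqrt (r - 3 / 4 * (q + 2 / sqrt 3 * y - q)\<^sup>2)) \<partial>lborel)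
      = (\<integral>\<^sup>+ y. ennreal (2 * sqrt (r - y\<^sup>2)) \<partial>lborel)"
    by (simp add: power_mult_distrib power_divide)
  also have "(\<integral>\<^sup>+ y. ennreal (2 * sqrt (r - y\<^sup>2)) \<partial>lborel) = emeasure lborel (cball (0::real \<times> real) (sqrt r))"
  proof -
    have "{x. (x, y) \<in> cball (0::real \<times> real) (sqrt r)} = {x. (x - 0)\<^sup>2 \<le> r - y\<^sup>2}" for y
      by (auto simp: dist_Pair_Pair zero_prod_def norm_Pair algebra_simps)
    then have "(\<integral>\<^sup>+ y. ennreal (2 * sqrt (r - y\<^sup>2)) \<partial>lborel)
        = (\<integral>\<^sup>+ y. emeasure lborel {x. (x, y) \<in> cball (0::real \<times> real) (sqrt r)} \<partial>lborel)"
      by (simp only: emeasure_square_le)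
    also have "\<dots> = emeasure lborel (cball (0::real \<times> real) (sqrt r))"
      by (rule slices[symmetric]) simp
    finally show ?thesis .
  qed
  also have "\<dots> = ennreal (pi * r)"
    using r by (subst emeasure_cball) (auto simp: eval_unit_ball_vol)
  finally show ?thesis using r by (simp add: ennreal_mult'[symmetric] field_simps)
qed

section \<open>Area of the region of angles that give a nearly equilateral triangle\<close>

lemma measurable_peri [measurable]:
  assumes [measurable]: "f \<in> borel_measurable M" "g \<in> borel_measurable M" "h \<in> borel_measurable M"
  shows "(\<lambda>w. peri (f w) (g w) (h w)) \<in> borel_measurable M"
  unfolding peri_def by measurable

definition angle_region :: "real \<Rightarrow> (real \<times> real) set" where
  "angle_region e = {(b, c). b \<in> {0..2*pi} \<and> c \<in> {0..2*pi} \<and>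
      3 * sqrt 3 - peri (circle_point 0) (circle_point b) (circle_point c) \<le> e}"

lemma angle_region_sets [measurable]: "angle_region e \<in> sets borel"
proof -
  have "angle_region e = {z \<in> space (borel \<Otimes>\<^sub>M borel). fst z \<in> {0..2*pi} \<and> snd z \<in> {0..2*pi} \<and>
      3 * sqrt 3 - peri (circle_point 0) (circle_point (fst z)) (circle_point (snd z)) \<le> e}"
    by (auto simp: angle_region_def space_pair_measure)
  also have "\<dots> \<in> sets (borel \<Otimes>\<^sub>M borel)" by measurable
  finally show ?thesis unfolding borel_prod .
qed

text \<open>The leading term is the area of two ellipses, one for each order of the free vertices,
  at level \<open>e\<close> divided by \<open>sqrt 3 / 4\<close>. The region contains two slightly
  smaller ellipses and is covered by two slightly larger ones.\<close>

lemma angle_region_bounds: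
  assumes e: "0 < e" "e \<le> 1 / 100"
  shows "\<bar>measure lborel (angle_region e) - 16 * pi * e / 3\<bar> \<le> 60 * (e * sqrt e)"
    and "emeasure lborel (angle_region e) = ennreal (measure lborel (angle_region e))"
proof -
  define El where "El r = {z :: real \<times> real. eqform (fst z - 2 * pi / 3) (snd z - 4 * pi / 3) \<le> r}" for r
  define El' where "El' r = {z :: real \<times> real. eqform (fst z - 4 * pi / 3) (snd z - 2 * pi / 3) \<le> r}" for r
  have meas: "El r \<in> sets borel" "El' r \<in> sets borel" for r
    unfolding El_def El'_def eqform_def
    by (intro borel_closed closed_Collect_le continuous_intros)+
  have area: "emeasure lborel (El r) = ennreal (2 * pi * r / sqrt 3)"
      "emeasure lborel (El' r) = ennreal (2 * pi * r / sqrt 3)" if "0 \<le> r" for r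
    unfolding El_def El'_def using that by (simp_all add: emeasure_ellipse)
  define D where "D b c = 3 * sqrt 3 - peri (circle_point 0) (circle_point b) (circle_point c)" for b c
  have D_swap: "D b c = D c b" for b c by (simp add: D_def peri_swap)
  \<comment> \<open>The relative error \<open>s / 6\<close> of \<open>peri_defect_approx\<close> at
    the scale \<open>s = 3 * sqrt e\<close>, which covers the level \<open>16 * e\<close>.\<close>
  define k where "k = sqrt e / 2"
  define s where "s = sqrt 3 / 4"
  have "sqrt e \<le> sqrt ((1 / 10)\<^sup>2)" using e by (simp add: power2_eq_square)
  then have k: "0 < k" "k \<le> 1 / 20" using e by (auto simp: k_def)
  have s: "0.43 < s" "s < 0.44" using sqrt3_bounds by (auto simp: s_def)
  have s3: "s * s = 3 / 16" by (simp add: s_def)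
  have approx: "\<bar>D b c - s * eqform (b - 2 * pi / 3) (c - 4 * pi / 3)\<bar> \<le> k * eqform (b - 2 * pi / 3) (c - 4 * pi / 3)"
    if "0 \<le> b" "b \<le> c" "c \<le> 2 * pi" "eqform (b - 2 * pi / 3) (c - 4 * pi / 3) \<le> 16 * e" for b c
    using peri_defect_approx[of b c "3 * sqrt e"] that e
    by (simp add: D_def k_def s_def power_mult_distrib)
  have upper: "eqform (b - 2 * pi / 3) (c - 4 * pi / 3) \<le> e / (s - k)"
    if "0 \<le> b" "b \<le> c" "c \<le> 2 * pi" "D b c \<le> e" for b c
  proof -
    have Q: "eqform (b - 2 * pi / 3) (c - 4 * pi / 3) \<le> 16 * e"
      using peri_defect_ge[of b c] that by (simp add: D_def)
    have "(s - k) * eqform (b - 2 * pi / 3) (c - 4 * pi / 3) \<le> e"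
      using approx[OF that(1-3) Q] that(4) by (simp add: abs_le_iff algebra_simps)
    then show ?thesis using k s by (simp add: field_simps)
  qed
  \<comment> \<open>The level is at most \<open>16 * e\<close>, so the ellipse is small enough both
    to force \<open>b < c\<close> and to apply the approximation.\<close>
  have lower: "0 \<le> b \<and> b < c \<and> c \<le> 2 * pi \<and> D b c \<le> e"
    if "eqform (b - 2 * pi / 3) (c - 4 * pi / 3) \<le> e / (s + k)" for b c
  proof -
    let ?Q = "eqform (b - 2 * pi / 3) (c - 4 * pi / 3)"
    have m: "(s + k) * ?Q \<le> e" using that k s by (simp add: field_simps)
    have "e / (s + k) \<le> 16 * e" using k s e mult_right_mono[of "1 / 16" "s + k" e] by (simp add: field_simps)
    then have Q: "?Q \<le> 16 * e" using that by linarith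
    have pi3: "pi > 3" by (rule pi_gt3)
    have bc: "0 \<le> b \<and> b < c \<and> c \<le> 2 * pi"
      using eqform_bounds[OF Q] e pi3 unfolding abs_less_iff by simp
    then show ?thesis using approx[of b c] Q m by (simp add: abs_le_iff algebra_simps)
  qed
  have eqform_commute: "eqform u v = eqform v u" for u v by (simp add: eqform_def)
  have sup: "angle_region e \<subseteq> El (e / (s - k)) \<union> El' (e / (s - k))"
  proof (safe, simp only: angle_region_def D_def[symmetric] mem_Collect_eq case_prod_conv atLeastAtMost_iff)
    fix b c assume *: "(0 \<le> b \<and> b \<le> 2 * pi) \<and> (0 \<le> c \<and> c \<le> 2 * pi) \<and> D b c \<le> e" and "(b, c) \<notin> El' (e / (s - k))"
    then have "\<not> c \<le> b" using upper[of c b] by (auto simp: El'_def D_swap[of b c] eqform_commute)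
    then show "(b, c) \<in> El (e / (s - k))" using upper[of b c] * by (auto simp: El_def)
  qed
  have sub: "El (e / (s + k)) \<union> El' (e / (s + k)) \<subseteq> angle_region e"
  proof (safe, goal_cases)
    case (1 b c)
    then show ?case using lower[of b c] by (auto simp: El_def angle_region_def D_def)
  next
    case (2 b c)
    then show ?case using lower[of c b]
      by (auto simp: El'_def angle_region_def D_def peri_swap[of _ "circle_point b"] eqform_commute)
  qed
  \<comment> \<open>A common point would satisfy both \<open>b < c\<close> and
    \<open>c < b\<close>.\<close>
  have disj: "El (e / (s + k)) \<inter> El' (e / (s + k)) = {}"
  proof -
    have False if "(b, c) \<in> El (e / (s + k))" "(b, c) \<in> El' (e / (s + k))" for b c
      using that lower[of b c] lower[of c b] by (auto simp: El_def El'_def eqform_commute)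
    then show ?thesis by auto
  qed
  have r0: "0 \<le> e / (s - k)" "0 \<le> e / (s + k)" using e k s by auto
  have a0: "0 \<le> 2 * pi * r / sqrt 3" if "0 \<le> r" for r using that by simp
  have a_eq: "2 * (2 * pi * (e / r) / sqrt 3) = pi * e / (s * r)" for r
    by (simp add: s_def mult.commute)
  have "emeasure lborel (angle_region e) \<le> emeasure lborel (El (e / (s - k)) \<union> El' (e / (s - k)))"
    using sup meas by (intro emeasure_mono) auto
  also have "\<dots> \<le> emeasure lborel (El (e / (s - k))) + emeasure lborel (El' (e / (s - k)))"
    using meas by (intro emeasure_subadditive) auto
  also have "\<dots> = ennreal (2 * (2 * pi * (e / (s - k)) / sqrt 3))"
    unfolding area[OF r0(1)] using a0[OF r0(1)] by (simp only: mult_2 ennreal_plus)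
  finally have up: "emeasure lborel (angle_region e) \<le> ennreal (2 * (2 * pi * (e / (s - k)) / sqrt 3))" .
  then show eq: "emeasure lborel (angle_region e) = ennreal (measure lborel (angle_region e))"
    by (intro emeasure_eq_ennreal_measure) (auto simp: top_unique)
  have "ennreal (2 * (2 * pi * (e / (s + k)) / sqrt 3)) = emeasure lborel (El (e / (s + k))) + emeasure lborel (El' (e / (s + k)))"
    unfolding area[OF r0(2)] using a0[OF r0(2)] by (simp only: mult_2 ennreal_plus)
  also have "\<dots> = emeasure lborel (El (e / (s + k)) \<union> El' (e / (s + k)))"
    using meas disj by (intro plus_emeasure) auto
  also have "\<dots> \<le> emeasure lborel (angle_region e)"
    using sub meas by (intro emeasure_mono) auto
  finally have lo: "ennreal (2 * (2 * pi * (e / (s + k)) / sqrt 3)) \<le> emeasure lborel (angle_region e)" .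
  let ?m = "measure lborel (angle_region e)"
  have m1: "?m \<le> pi * e / (s * (s - k))"
    using up a0[OF r0(1)] unfolding eq a_eq[symmetric] by (subst (asm) ennreal_le_iff) simp_all
  have m2: "pi * e / (s * (s + k)) \<le> ?m"
    using lo unfolding eq a_eq[symmetric] by (subst (asm) ennreal_le_iff) simp_all
  have c: "16 * pi * e / 3 = pi * e / (s * s)" by (simp add: s3)
  have "pi * e / (s * (s - k)) - pi * e / (s * s) = pi * e * k / (s * s * (s - k))"
    using s k by (simp add: divide_simps) (simp add: algebra_simps)
  \<comment> \<open>Uses \<open>s * s = 3 / 16\<close> and that \<open>s - k\<close> exceeds 1/5; as
    \<open>k\<close> is half of \<open>sqrt e\<close>, the constant is 160/3, below 60.\<close>
  also have "\<dots> \<le> 4 * e * k / (3 / 16 * (1 / 5))"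
    unfolding s3 using s k e pi_less_4 by (intro frac_le mult_mono) auto
  also have "\<dots> \<le> 60 * (e * sqrt e)" using e by (simp add: k_def)
  finally have b1: "pi * e / (s * (s - k)) - pi * e / (s * s) \<le> 60 * (e * sqrt e)" .
  have "pi * e / (s * s) - pi * e / (s * (s + k)) = pi * e * k / (s * s * (s + k))"
    using s k add_pos_pos[of s k] by (simp add: divide_simps) (simp add: algebra_simps)
  also have "\<dots> \<le> 4 * e * k / (3 / 16 * (1 / 5))"
    unfolding s3 using s k e pi_less_4 by (intro frac_le mult_mono) auto
  also have "\<dots> \<le> 60 * (e * sqrt e)" using e by (simp add: k_def)
  finally have b2: "pi * e / (s * s) - pi * e / (s * (s + k)) \<le> 60 * (e * sqrt e)" .
  show "\<bar>?m - 16 * pi * e / 3\<bar> \<le> 60 * (e * sqrt e)"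
    using m1 m2 b1 b2 unfolding c abs_le_iff by linarith
qed

section \<open>The uniform law on the circle and its rotation invariance\<close>

lemma nn_integral_periodic_shift:
  fixes g :: "real \<Rightarrow> ennreal"
  assumes [measurable]: "g \<in> borel_measurable borel" and per: "\<And>x. g (x + T) = g x"
    and a: "0 \<le> a" "a \<le> T"
  shows "(\<integral>\<^sup>+ x. g (x - a) * indicator {0..T} x \<partial>lborel) = (\<integral>\<^sup>+ x. g x * indicator {0..T} x \<partial>lborel)"
proof -
  have "(\<integral>\<^sup>+ x. g (x - a) * indicator {0..T} x \<partial>lborel)
      = (\<integral>\<^sup>+ x. g x * indicator {0..T} (a + x) \<partial>lborel)"
    by (subst nn_integral_real_affine[where t = a and c = 1]) auto
  \<comment> \<open>After translation the domain is the interval from \<open>-a\<close> to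
    \<open>T - a\<close>; its part left of 0 is then moved by one period.\<close>
  also have "\<dots> = (\<integral>\<^sup>+ x. g x * indicator {-a..<0} x + g x * indicator {0..T - a} x \<partial>lborel)"
    by (rule nn_integral_cong) (use a in \<open>auto simp: indicator_def\<close>)
  also have "\<dots> = (\<integral>\<^sup>+ x. g x * indicator {-a..<0} x \<partial>lborel) + (\<integral>\<^sup>+ x. g x * indicator {0..T - a} x \<partial>lborel)"
    by (rule nn_integral_add) auto
  also have "(\<integral>\<^sup>+ x. g x * indicator {-a..<0} x \<partial>lborel)
      = (\<integral>\<^sup>+ x. g (-T + x) * indicator {-a..<0} (-T + x) \<partial>lborel)"
    by (subst nn_integral_real_affine[where t = "-T" and c = 1]) auto
  also have "\<dots> = (\<integral>\<^sup>+ x. g x * indicator {T - a..<T} x \<partial>lborel)"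
    by (rule nn_integral_cong) (use per[of "_ - T"] in \<open>auto simp: indicator_def\<close>)
  also have "\<dots> + (\<integral>\<^sup>+ x. g x * indicator {0..T - a} x \<partial>lborel)
      = (\<integral>\<^sup>+ x. g x * indicator {T - a..<T} x + g x * indicator {0..T - a} x \<partial>lborel)"
    by (rule nn_integral_add[symmetric]) auto
  \<comment> \<open>The pieces fit together except possibly at \<open>T - a\<close> and
    \<open>T\<close>, which are null.\<close>
  also have "\<dots> = (\<integral>\<^sup>+ x. g x * indicator {0..T} x \<partial>lborel)"
    using AE_lborel_singleton[of "T - a"] AE_lborel_singleton[of T]
    by (intro nn_integral_cong_AE, eventually_elim) (use a in \<open>auto simp: indicator_def\<close>)
  finally show ?thesis .
qed

abbreviation unif_angle :: "real measure" where
  "unif_angle \<equiv> uniform_measure lborel {0..2 * pi}"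

lemma prob_space_unif_angle: "prob_space unif_angle"
  by (rule prob_space_uniform_measure) auto

lemma nn_integral_unif_angle:
  assumes "f \<in> borel_measurable borel"
  shows "(\<integral>\<^sup>+ x. f x \<partial>unif_angle) = (\<integral>\<^sup>+ x. f x * indicator {0..2*pi} x \<partial>lborel) / ennreal (2 * pi)"
  using assms by (subst nn_integral_uniform_measure) auto

lemma nn_integral_uniform_circle:
  assumes [measurable]: "f \<in> borel_measurable borel"
  shows "(\<integral>\<^sup>+ x. f x \<partial>uniform_circle) = (\<integral>\<^sup>+ \<theta>. f (circle_point \<theta>) \<partial>unif_angle)"
  unfolding uniform_circle_def by (subst nn_integral_distr) auto

lemma nn_integral_unif_angle_shift:
  assumes [measurable]: "g \<in> borel_measurable borel" and per: "\<And>x. g (x + 2 * pi) = g x"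
    and a: "a \<in> {0..2 * pi}"
  shows "(\<integral>\<^sup>+ x. g (x - a) \<partial>unif_angle) = (\<integral>\<^sup>+ x. g x \<partial>unif_angle)"
  using nn_integral_periodic_shift[OF assms(1,2), of a] a by (simp add: nn_integral_unif_angle)

lemma sets_uniform_circle [simp, measurable_cong]: "sets uniform_circle = sets borel"
  by (simp add: uniform_circle_def)

lemma circle_point_periodic: "circle_point (x + 2 * pi) = circle_point x"
  by (simp add: circle_point_def)

lemma AE_uniform_circle_eq_circle_point: "AE x in uniform_circle. \<exists>a\<in>{0..2*pi}. x = circle_point a"
proof -
  have "AE x in uniform_circle. norm x = 1"
    unfolding uniform_circle_def by (subst AE_distr_iff) (auto simp: norm_circle_point)
  then show ?thesis by eventually_elim (metis circle_point_onto add_0)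
qed

text \<open>After a rotation the admissible angles lie in two intervals of length
  \<open>10 * d\<close>. Dividing their total by \<open>2 * pi\<close> gives
  \<open>10 * d / pi\<close>, which is below \<open>4 * d\<close>.\<close>

lemma uniform_circle_side_le:
  assumes d: "0 \<le> d" and a: "a \<in> {0..2*pi}"
  shows "emeasure uniform_circle {y. \<bar>norm (circle_point a - y) - sqrt 3\<bar> \<le> d} \<le> ennreal (4 * d)"
proof -
  let ?g = "\<lambda>x. indicator {b. \<bar>norm (circle_point 0 - circle_point b) - sqrt 3\<bar> \<le> d} x :: ennreal"
  let ?A = "{2 * pi / 3 - 5 * d .. 2 * pi / 3 + 5 * d}" and ?B = "{4 * pi / 3 - 5 * d .. 4 * pi / 3 + 5 * d}"
  have "emeasure uniform_circle {y. \<bar>norm (circle_point a - y) - sqrt 3\<bar> \<le> d}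
      = (\<integral>\<^sup>+ y. indicator {y. \<bar>norm (circle_point a - y) - sqrt 3\<bar> \<le> d} y \<partial>uniform_circle)"
    by (simp add: nn_integral_indicator)
  also have "\<dots> = (\<integral>\<^sup>+ b. indicator {y. \<bar>norm (circle_point a - y) - sqrt 3\<bar> \<le> d} (circle_point b) \<partial>unif_angle)"
    by (rule nn_integral_uniform_circle) measurable
  also have "\<dots> = (\<integral>\<^sup>+ b. ?g (b - a) \<partial>unif_angle)"
  proof -
    have "norm (circle_point a - circle_point b) = norm (circle_point 0 - circle_point (b - a))" for b
      by (simp only: norm_circle_point_diff diff_0 minus_diff_eq)
    then show ?thesis by (simp add: indicator_def)
  qed
  also have "\<dots> = (\<integral>\<^sup>+ b. ?g b \<partial>unif_angle)"
    by (rule nn_integral_unif_angle_shift[OF _ _ a]) (measurable, simp add: circle_point_periodic indicator_def)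
  also have "\<dots> = (\<integral>\<^sup>+ b. ?g b * indicator {0..2*pi} b \<partial>lborel) / ennreal (2 * pi)"
    by (rule nn_integral_unif_angle) measurable
  also have "\<dots> \<le> (\<integral>\<^sup>+ b. indicator (?A \<union> ?B) b \<partial>lborel) / ennreal (2 * pi)"
  proof (intro divide_right_mono_ennreal nn_integral_mono)
    fix b show "?g b * indicator {0..2*pi} b \<le> indicator (?A \<union> ?B) b"
      using side_near_sqrt3_angle[of b d] by (auto simp: indicator_def abs_le_iff split: if_splits)
  qed
  also have "(\<integral>\<^sup>+ b. indicator (?A \<union> ?B) b \<partial>lborel) \<le> emeasure lborel ?A + emeasure lborel ?B"
    by (simp only: nn_integral_indicator sets_lborel atLeastAtMost_borel sets.Un) (rule emeasure_subadditive; simp)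
  also have "\<dots> = ennreal (20 * d)" using d by (simp flip: ennreal_plus)
  also have "ennreal (20 * d) / ennreal (2 * pi) = ennreal (10 * d / pi)"
    using d by (simp add: divide_ennreal)
  also have "\<dots> \<le> ennreal (4 * d)"
    using d pi_gt3 mult_left_mono[of 3 pi d] by (intro ennreal_leI) (simp add: field_simps)
  finally show ?thesis by (auto intro: divide_right_mono_ennreal)
qed

text \<open>By rotation invariance the first point may be fixed at angle 0; the other two angles are
  then uniform on a square of area \<open>4 * pi\<^sup>2\<close>.\<close>

lemma near_equilateral_probability:
  "(\<integral>\<^sup>+ x. \<integral>\<^sup>+ y. emeasure uniform_circle {z. 3 * sqrt 3 - peri x y z \<le> e} \<partial>uniform_circle \<partial>uniform_circle)
     = emeasure lborel (angle_region e) / ennreal (4 * pi\<^sup>2)"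
proof -
  interpret circ: prob_space uniform_circle by (rule prob_space_uniform_circle)
  interpret ang: prob_space unif_angle by (rule prob_space_unif_angle)
  let ?d = "\<lambda>x y z. indicator {w. w \<le> e} (3 * sqrt 3 - peri x y z) :: ennreal"
  have inner: "emeasure uniform_circle {z. 3 * sqrt 3 - peri x y z \<le> e} = (\<integral>\<^sup>+ c. ?d x y (circle_point c) \<partial>unif_angle)" for x y
  proof -
    have "emeasure uniform_circle {z. 3 * sqrt 3 - peri x y z \<le> e} = (\<integral>\<^sup>+ z. indicator {z. 3 * sqrt 3 - peri x y z \<le> e} z \<partial>uniform_circle)"
      by (rule nn_integral_indicator[symmetric]) measurable
    also have "\<dots> = (\<integral>\<^sup>+ z. ?d x y z \<partial>uniform_circle)" by (simp add: indicator_def)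
    finally show ?thesis by (simp add: nn_integral_uniform_circle)
  qed
  define F where "F x = (\<integral>\<^sup>+ b. \<integral>\<^sup>+ c. ?d x (circle_point b) (circle_point c) \<partial>unif_angle \<partial>unif_angle)" for x
  have F: "(\<integral>\<^sup>+ y. emeasure uniform_circle {z. 3 * sqrt 3 - peri x y z \<le> e} \<partial>uniform_circle) = F x" for x
    unfolding inner F_def by (rule nn_integral_uniform_circle) measurable
  \<comment> \<open>Perimeters depend on angle differences only, so both remaining angles are
    shifted by \<open>a\<close>; the shifts are then removed one at a time, the inner integral
    first.\<close>
  have F_const: "F (circle_point a) = F (circle_point 0)" if a: "a \<in> {0..2*pi}" for a
  proof -
    have "F (circle_point a) = (\<integral>\<^sup>+ b. \<integral>\<^sup>+ c. ?d (circle_point 0) (circle_point (b - a)) (circle_point (c - a)) \<partial>unif_angle \<partial>unif_angle)"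
      unfolding F_def by (simp add: peri_circle_point)
    also have "\<dots> = (\<integral>\<^sup>+ b. \<integral>\<^sup>+ c. ?d (circle_point 0) (circle_point (b - a)) (circle_point c) \<partial>unif_angle \<partial>unif_angle)"
      by (intro nn_integral_cong nn_integral_unif_angle_shift[OF _ _ a]) (measurable, simp add: circle_point_periodic)
    also have "\<dots> = F (circle_point 0)"
      unfolding F_def
      by (intro nn_integral_unif_angle_shift[OF _ _ a]) (measurable, simp add: circle_point_periodic)
    finally show ?thesis .
  qed
  have "(\<integral>\<^sup>+ x. F x \<partial>uniform_circle) = (\<integral>\<^sup>+ x. F (circle_point 0) \<partial>uniform_circle)"
  proof (rule nn_integral_cong_AE)
    show "AE x in uniform_circle. F x = F (circle_point 0)"
      using AE_uniform_circle_eq_circle_point by eventually_elim (metis F_const)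
  qed
  also have "\<dots> = F (circle_point 0)" by (simp add: circ.emeasure_space_1)
  also have "\<dots> = (\<integral>\<^sup>+ b. (\<integral>\<^sup>+ c. ?d (circle_point 0) (circle_point b) (circle_point c) * indicator {0..2*pi} c \<partial>lborel) / ennreal (2 * pi) \<partial>unif_angle)"
    unfolding F_def by (intro nn_integral_cong nn_integral_unif_angle) measurable
  also have "\<dots> = (\<integral>\<^sup>+ b. (\<integral>\<^sup>+ c. ?d (circle_point 0) (circle_point b) (circle_point c) * indicator {0..2*pi} c \<partial>lborel) / ennreal (2 * pi) * indicator {0..2*pi} b \<partial>lborel) / ennreal (2 * pi)"
    by (intro nn_integral_unif_angle) measurable
  also have "\<dots> = (\<integral>\<^sup>+ b. \<integral>\<^sup>+ c. indicator (angle_region e) (b, c) \<partial>lborel \<partial>lborel) / ennreal (2 * pi) / ennreal (2 * pi)"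
  proof -
    have "(\<integral>\<^sup>+ c. ?d (circle_point 0) (circle_point b) (circle_point c) * indicator {0..2*pi} c \<partial>lborel) / ennreal (2 * pi) * indicator {0..2*pi} b
        = (\<integral>\<^sup>+ c. indicator (angle_region e) (b, c) \<partial>lborel) / ennreal (2 * pi)" for b
    proof -
      have "(\<integral>\<^sup>+ c. ?d (circle_point 0) (circle_point b) (circle_point c) * indicator {0..2*pi} c \<partial>lborel) * indicator {0..2*pi} b
        = (\<integral>\<^sup>+ c. ?d (circle_point 0) (circle_point b) (circle_point c) * indicator {0..2*pi} c * indicator {0..2*pi} b \<partial>lborel)"
        by (rule nn_integral_multc[symmetric]) measurable
      also have "\<dots> = (\<integral>\<^sup>+ c. indicator (angle_region e) (b, c) \<partial>lborel)"
        by (intro nn_integral_cong) (auto simp: angle_region_def indicator_def)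
      finally show ?thesis by (simp add: divide_ennreal_def mult_ac)
    qed
    moreover have "(\<integral>\<^sup>+ b. (\<integral>\<^sup>+ c. indicator (angle_region e) (b, c) \<partial>lborel) / ennreal (2 * pi) \<partial>lborel)
        = (\<integral>\<^sup>+ b. \<integral>\<^sup>+ c. indicator (angle_region e) (b, c) \<partial>lborel \<partial>lborel) / ennreal (2 * pi)"
      by (rule nn_integral_divide) (simp add: borel_prod, measurable)
    ultimately show ?thesis by simp
  qed
  also have "(\<integral>\<^sup>+ b. \<integral>\<^sup>+ c. indicator (angle_region e) (b, c) \<partial>lborel \<partial>lborel) = emeasure lborel (angle_region e)"
  proof -
    have "angle_region e \<in> sets (lborel \<Otimes>\<^sub>M lborel)" unfolding lborel_prod by simp
    from lborel.emeasure_pair_measure[OF this] show ?thesis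
      by (simp add: lborel_prod)
  qed
  also have "\<dots> / ennreal (2 * pi) / ennreal (2 * pi) = \<dots> / ennreal (4 * pi\<^sup>2)"
  proof -
    have "inverse (ennreal (2 * pi)) * inverse (ennreal (2 * pi)) = inverse (ennreal (4 * pi\<^sup>2))"
      using inverse_ennreal[of "2 * pi"] inverse_ennreal[of "4 * pi\<^sup>2"] ennreal_mult[of "inverse (2 * pi)" "inverse (2 * pi)"]
      by (simp add: power2_eq_square)
    then show ?thesis unfolding divide_ennreal_def mult.assoc by (rule arg_cong)
  qed
  finally show ?thesis unfolding F .
qed

section \<open>Independent uniform points on the circle\<close>

text \<open>Indexing by vertex sets makes the dependence structure visible: the predicate reads
  \<open>u\<close> only on \<open>A\<close>, so disjoint sets will give independent events.\<close>

definition near_equilateral :: "real \<Rightarrow> (nat \<Rightarrow> real^2) \<Rightarrow> nat set \<Rightarrow> bool" where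
  "near_equilateral e u A \<longleftrightarrow> (\<exists>i\<in>A. \<exists>j\<in>A. \<exists>l\<in>A. i < j \<and> j < l \<and> 3 * sqrt 3 - peri (u i) (u j) (u l) \<le> e)"

lemma near_equilateral_restrict [simp]: "near_equilateral e (restrict u A) A = near_equilateral e u A"
  by (auto simp: near_equilateral_def)

lemma near_equilateral_cong: "(\<And>i. i \<in> A \<Longrightarrow> u i = v i) \<Longrightarrow> near_equilateral e u A = near_equilateral e v A"
  by (auto simp: near_equilateral_def)

lemma card_3_increasing:
  assumes "card (A :: nat set) = 3"
  obtains i j l where "A = {i, j, l}" "i < j" "j < l"
proof -
  obtain x y z where A: "A = {x, y, z}" "x \<noteq> y" "x \<noteq> z" "y \<noteq> z"
    using assms by (auto simp: card_3_iff)
  consider "x < y" "y < z" | "x < z" "z < y" | "y < x" "x < z" | "y < z" "z < x" | "z < x" "x < y" | "z < y" "y < x"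
    using A(2-4) by linarith
  then show ?thesis
  proof cases
    case 1
    then show ?thesis using that[of x y z] A(1) by blast
  next
    case 2
    then show ?thesis using that[of x z y] A(1) by blast
  next
    case 3
    then show ?thesis using that[of y x z] A(1) by blast
  next
    case 4
    then show ?thesis using that[of y z x] A(1) by blast
  next
    case 5
    then show ?thesis using that[of z x y] A(1) by blast
  next
    case 6
    then show ?thesis using that[of z y x] A(1) by blast
  qed
qed

lemma near_equilateral_triple:
  assumes "i < j" "j < l"
  shows "near_equilateral e u {i, j, l} \<longleftrightarrow> 3 * sqrt 3 - peri (u i) (u j) (u l) \<le> e"
proof
  assume "near_equilateral e u {i, j, l}"
  then obtain a b c where abc: "{a, b, c} \<subseteq> {i, j, l}" "a < b" "b < c" "3 * sqrt 3 - peri (u a) (u b) (u c) \<le> e"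
    unfolding near_equilateral_def by blast
  have "a = i \<and> b = j \<and> c = l" using abc(1-3) assms by auto
  then show "3 * sqrt 3 - peri (u i) (u j) (u l) \<le> e" using abc(4) by simp
next
  assume "3 * sqrt 3 - peri (u i) (u j) (u l) \<le> e"
  then show "near_equilateral e u {i, j, l}" using assms unfolding near_equilateral_def by blast
qed

lemma near_equilateral_side:
  assumes A: "card A = 3" and ik: "i \<in> A" "k \<in> A" "i \<noteq> k"
    and circle: "\<And>j. j \<in> A \<Longrightarrow> norm (u j) = 1" and near: "near_equilateral e u A"
  shows "\<bar>norm (u i - u k) - sqrt 3\<bar> \<le> 6 * sqrt e"
proof -
  obtain a b c where abc: "A = {a, b, c}" "a < b" "b < c" using card_3_increasing[OF A] .
  then have D: "3 * sqrt 3 - peri (u a) (u b) (u c) \<le> e" using near near_equilateral_triple by simp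
  have N: "norm (u a) = 1" "norm (u b) = 1" "norm (u c) = 1" using circle abc by auto
  have D': "3 * sqrt 3 - peri (u b) (u c) (u a) \<le> e" "3 * sqrt 3 - peri (u c) (u a) (u b) \<le> e"
    using D by (metis peri_rotate)+
  have s: "\<bar>norm (u a - u b) - sqrt 3\<bar> \<le> 6 * sqrt e" "\<bar>norm (u b - u c) - sqrt 3\<bar> \<le> 6 * sqrt e"
      "\<bar>norm (u c - u a) - sqrt 3\<bar> \<le> 6 * sqrt e"
    using near_equilateral_triangle_side[OF N(1,2,3) D] near_equilateral_triangle_side[OF N(2,3,1) D'(1)]
      near_equilateral_triangle_side[OF N(3,1,2) D'(2)] .
  then have s': "\<bar>norm (u b - u a) - sqrt 3\<bar> \<le> 6 * sqrt e" "\<bar>norm (u c - u b) - sqrt 3\<bar> \<le> 6 * sqrt e"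
      "\<bar>norm (u a - u c) - sqrt 3\<bar> \<le> 6 * sqrt e"
    by (metis norm_minus_commute)+
  consider "i = a" "k = b" | "i = a" "k = c" | "i = b" "k = a" | "i = b" "k = c" | "i = c" "k = a" | "i = c" "k = b"
    using ik abc(1) by auto
  then show ?thesis using s s' by cases simp_all
qed

lemma near_equilateral_sets:
  assumes "A \<subseteq> K"
  shows "{u \<in> space (PiM K (\<lambda>_. borel)). near_equilateral e u A} \<in> sets (PiM K (\<lambda>_. borel))"
proof -
  have c: "(\<lambda>u. u i) \<in> borel_measurable (PiM K (\<lambda>_. borel))" if "i \<in> A" for i
    using that assms by (intro measurable_component_singleton) auto
  have "{u \<in> space (PiM K (\<lambda>_. borel)). near_equilateral e u A}
     = (\<Union>i\<in>A. \<Union>j\<in>A. \<Union>l\<in>A. {u \<in> space (PiM K (\<lambda>_. borel)). i < j \<and> j < l \<and> 3 * sqrt 3 - peri (u i) (u j) (u l) \<le> e})"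
    by (auto simp: near_equilateral_def)
  also have "\<dots> \<in> sets (PiM K (\<lambda>_. borel))"
  proof (intro sets.countable_UN'' countableI_type)
    fix i j l assume "i \<in> A" "j \<in> A" "l \<in> A"
    note [measurable] = c[OF \<open>i \<in> A\<close>] c[OF \<open>j \<in> A\<close>] c[OF \<open>l \<in> A\<close>]
    show "{u \<in> space (PiM K (\<lambda>_. borel)). i < j \<and> j < l \<and> 3 * sqrt 3 - peri (u i) (u j) (u l) \<le> e} \<in> sets (PiM K (\<lambda>_. borel))"
      by measurable
  qed
  finally show ?thesis .
qed

section \<open>Integrating out independent variables\<close>

context prob_space
begin

lemma emeasure_indep_pair:
  assumes ind: "indep_var N1 Z N2 Y" and S: "S \<in> sets (N1 \<Otimes>\<^sub>M N2)"
  shows "emeasure M {\<omega>\<in>space M. (Z \<omega>, Y \<omega>) \<in> S} = (\<integral>\<^sup>+ z. emeasure (distr M N2 Y) (Pair z -` S) \<partial>distr M N1 Z)"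
proof -
  have Z: "Z \<in> measurable M N1" and Y: "Y \<in> measurable M N2"
    and eq: "distr M N1 Z \<Otimes>\<^sub>M distr M N2 Y = distr M (N1 \<Otimes>\<^sub>M N2) (\<lambda>\<omega>. (Z \<omega>, Y \<omega>))"
    using ind unfolding indep_var_distribution_eq by auto
  interpret Y: prob_space "distr M N2 Y" by (rule prob_space_distr[OF Y])
  have m: "(\<lambda>\<omega>. (Z \<omega>, Y \<omega>)) \<in> measurable M (N1 \<Otimes>\<^sub>M N2)" using Z Y by simp
  have "emeasure M {\<omega>\<in>space M. (Z \<omega>, Y \<omega>) \<in> S} = emeasure (distr M (N1 \<Otimes>\<^sub>M N2) (\<lambda>\<omega>. (Z \<omega>, Y \<omega>))) S"
    unfolding emeasure_distr[OF m S] by (rule arg_cong[where f = "emeasure M"]) auto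
  also have "\<dots> = (\<integral>\<^sup>+ z. emeasure (distr M N2 Y) (Pair z -` S) \<partial>distr M N1 Z)"
    unfolding eq[symmetric] by (rule Y.emeasure_pair_measure_alt) (use S in simp)
  finally show ?thesis .
qed

text \<open>Tonelli for one further variable, conditioning on those indexed by \<open>A\<close>.
  Independence is available for the families over \<open>A\<close> and \<open>{k}\<close>;
  evaluation at \<open>k\<close> replaces the second family by \<open>X k\<close>.\<close>

lemma emeasure_indep_vars_insert:
  assumes ind: "indep_vars M' X I" and A: "A \<subseteq> I" and k: "k \<in> I" "k \<notin> A"
    and S: "S \<in> sets (PiM A M' \<Otimes>\<^sub>M M' k)"
  shows "emeasure M {\<omega>\<in>space M. (restrict (\<lambda>i. X i \<omega>) A, X k \<omega>) \<in> S}
    = (\<integral>\<^sup>+ z. emeasure (distr M (M' k) (X k)) (Pair z -` S) \<partial>distr M (PiM A M') (\<lambda>\<omega>. restrict (\<lambda>i. X i \<omega>) A))"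
proof -
  let ?Z = "\<lambda>\<omega>. restrict (\<lambda>i. X i \<omega>) A" and ?Y = "\<lambda>\<omega>. restrict (\<lambda>i. X i \<omega>) {k}"
  let ?h = "\<lambda>w. (fst w, snd w k)"
  let ?S = "?h -` S \<inter> space (PiM A M' \<Otimes>\<^sub>M PiM {k} M')"
  have indZY: "indep_var (PiM A M') ?Z (PiM {k} M') ?Y"
    using A k by (intro indep_var_restrict[OF ind]) auto
  have Xk: "X k \<in> measurable M (M' k)" using ind k by (auto simp: indep_vars_def)
  have Z: "?Z \<in> measurable M (PiM A M')" and Y: "?Y \<in> measurable M (PiM {k} M')"
    using indZY unfolding indep_var_distribution_eq by auto
  have "?h \<in> measurable (PiM A M' \<Otimes>\<^sub>M PiM {k} M') (PiM A M' \<Otimes>\<^sub>M M' k)"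
    by (intro measurable_Pair measurable_fst measurable_compose[OF measurable_snd] measurable_component_singleton) simp
  from measurable_sets[OF this S] have S': "?S \<in> sets (PiM A M' \<Otimes>\<^sub>M PiM {k} M')" .
  have "{\<omega>\<in>space M. (?Z \<omega>, X k \<omega>) \<in> S} = {\<omega>\<in>space M. (?Z \<omega>, ?Y \<omega>) \<in> ?S}"
    using measurable_space[OF Z] measurable_space[OF Y] by (auto simp: space_pair_measure)
  then have "emeasure M {\<omega>\<in>space M. (?Z \<omega>, X k \<omega>) \<in> S}
      = (\<integral>\<^sup>+ z. emeasure (distr M (PiM {k} M') ?Y) (Pair z -` ?S) \<partial>distr M (PiM A M') ?Z)"
    using emeasure_indep_pair[OF indZY S'] by simp
  also have "\<dots> = (\<integral>\<^sup>+ z. emeasure (distr M (M' k) (X k)) (Pair z -` S) \<partial>distr M (PiM A M') ?Z)"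
  proof (rule nn_integral_cong)
    fix z assume "z \<in> space (distr M (PiM A M') ?Z)"
    then have z: "z \<in> space (PiM A M')" by simp
    have "?Y -` (Pair z -` ?S) \<inter> space M = X k -` (Pair z -` S) \<inter> space M"
      using z measurable_space[OF Y] by (auto simp: space_pair_measure)
    then show "emeasure (distr M (PiM {k} M') ?Y) (Pair z -` ?S) = emeasure (distr M (M' k) (X k)) (Pair z -` S)"
      using sets_Pair1[OF S', of z] sets_Pair1[OF S, of z] by (simp add: emeasure_distr[OF Y] emeasure_distr[OF Xk])
  qed
  finally show ?thesis .
qed

text \<open>Given the centre \<open>X i\<close>, each leaf \<open>X k\<close> falls into a section
  of \<open>R\<close> of probability at most \<open>r\<close>, whatever the centre is. Leaves are
  added one by one, each independent of the centre and the earlier leaves.\<close>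

lemma indep_star_prob_le:
  assumes ind: "indep_vars (\<lambda>_. borel) X J" and i: "i \<in> J" and K: "finite K" "K \<subseteq> J" "i \<notin> K"
    and R: "R \<in> sets (borel \<Otimes>\<^sub>M borel)" and r: "0 \<le> r"
    and le: "\<And>k x. k \<in> K \<Longrightarrow> emeasure (distr M borel (X k)) (Pair x -` R) \<le> ennreal r"
  shows "prob {\<omega>\<in>space M. \<forall>k\<in>K. (X i \<omega>, X k \<omega>) \<in> R} \<le> r ^ card K"
  using K le
proof (induction K rule: finite_induct)
  case empty
  then show ?case by simp
next
  case (insert k K)
  let ?P = "PiM (insert i K) (\<lambda>_. borel)"
  let ?Z = "\<lambda>\<omega>. restrict (\<lambda>j. X j \<omega>) (insert i K)"
  \<comment> \<open>The event for the earlier leaves, kept together with the centre, since the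
    condition on the new leaf refers to the value at \<open>i\<close>.\<close>
  define T where "T = {z \<in> space ?P. \<forall>j\<in>K. (z i, z j) \<in> R}"
  have rv: "random_variable borel (X j)" if "j \<in> J" for j using ind that by (auto simp: indep_vars_def)
  have comp: "(\<lambda>z. z j) \<in> measurable ?P borel" if "j \<in> insert i K" for j
    using that by (rule measurable_component_singleton)
  have pairR: "{z \<in> space ?P. (z i, z j) \<in> R} \<in> sets ?P" if "j \<in> K" for j
    using measurable_sets[OF measurable_Pair[OF comp[of i] comp[of j]] R] that
    by (simp add: vimage_def Int_def conj_commute)
  have T: "T \<in> sets ?P"
    unfolding T_def using insert.hyps(1) pairR by (intro sets.sets_Collect_finite_All) auto
  let ?S = "{w \<in> space (?P \<Otimes>\<^sub>M borel). fst w \<in> T \<and> (fst w i, snd w) \<in> R}"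
  have S: "?S \<in> sets (?P \<Otimes>\<^sub>M borel)"
  proof -
    have a: "{w \<in> space (?P \<Otimes>\<^sub>M borel). fst w \<in> T} \<in> sets (?P \<Otimes>\<^sub>M borel)"
      using measurable_sets[OF measurable_fst T] by (simp add: vimage_def Int_def conj_commute)
    have "(\<lambda>w. (fst w i, snd w)) \<in> measurable (?P \<Otimes>\<^sub>M borel) (borel \<Otimes>\<^sub>M borel)"
      by (intro measurable_Pair measurable_compose[OF measurable_fst comp] measurable_snd) simp
    from measurable_sets[OF this R]
    have b: "{w \<in> space (?P \<Otimes>\<^sub>M borel). (fst w i, snd w) \<in> R} \<in> sets (?P \<Otimes>\<^sub>M borel)"
      by (simp add: vimage_def Int_def conj_commute)
    from sets.Int[OF a b] show ?thesis by (simp add: Int_def conj_ac)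
  qed
  have Zmeas: "?Z \<in> measurable M ?P"
    using insert.prems i rv by (intro measurable_restrict) auto
  have Ej: "{\<omega>\<in>space M. \<forall>j\<in>K. (X i \<omega>, X j \<omega>) \<in> R} = ?Z -` T \<inter> space M"
    using measurable_space[OF Zmeas] by (auto simp: T_def)
  have "{\<omega>\<in>space M. \<forall>j\<in>insert k K. (X i \<omega>, X j \<omega>) \<in> R} = {\<omega>\<in>space M. (?Z \<omega>, X k \<omega>) \<in> ?S}"
    using measurable_space[OF Zmeas] Ej by (auto simp: space_pair_measure)
  note E2 = this
  have "emeasure M {\<omega>\<in>space M. \<forall>j\<in>insert k K. (X i \<omega>, X j \<omega>) \<in> R}
      = (\<integral>\<^sup>+ z. emeasure (distr M borel (X k)) (Pair z -` ?S) \<partial>distr M ?P ?Z)"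
    unfolding E2 using i insert.hyps insert.prems by (intro emeasure_indep_vars_insert[OF ind _ _ _ S]) auto
  also have "\<dots> \<le> (\<integral>\<^sup>+ z. ennreal r * indicator T z \<partial>distr M ?P ?Z)"
  proof (rule nn_integral_mono)
    fix z assume "z \<in> space (distr M ?P ?Z)"
    have "Pair (z i) -` R \<in> sets borel" using R by (rule sets_Pair1)
    then have "z \<in> T \<Longrightarrow> emeasure (distr M borel (X k)) (Pair z -` ?S) \<le> emeasure (distr M borel (X k)) (Pair (z i) -` R)"
      by (intro emeasure_mono) auto
    moreover have "z \<notin> T \<Longrightarrow> Pair z -` ?S = {}" by auto
    ultimately show "emeasure (distr M borel (X k)) (Pair z -` ?S) \<le> ennreal r * indicator T z"
      using insert.prems(3)[of k "z i"] by (cases "z \<in> T") auto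
  qed
  also have "\<dots> = ennreal r * emeasure M {\<omega>\<in>space M. \<forall>j\<in>K. (X i \<omega>, X j \<omega>) \<in> R}"
    using T Zmeas unfolding Ej by (simp add: nn_integral_cmult_indicator emeasure_distr)
  also have "\<dots> \<le> ennreal r * ennreal (r ^ card K)"
    using insert.IH insert.prems by (intro mult_left_mono) (auto simp: emeasure_eq_measure ennreal_leI)
  also have "\<dots> = ennreal (r ^ card (insert k K))"
    using insert.hyps r by (simp add: ennreal_mult)
  finally show ?case using r by (simp add: emeasure_eq_measure)
qed

end

section \<open>Near-equilateral events of the sample\<close>

locale circle_sample = prob_space +
  fixes U :: "nat \<Rightarrow> 'a \<Rightarrow> real^2"
  assumes indep: "indep_vars (\<lambda>_. borel) U {1..}"
    and distr_U: "\<And>i. i \<ge> 1 \<Longrightarrow> distr M borel (U i) = uniform_circle"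
begin

lemma U_measurable: "i \<ge> 1 \<Longrightarrow> U i \<in> borel_measurable M"
  using indep by (auto simp: indep_vars_def)

lemma AE_norm_U: "i \<ge> 1 \<Longrightarrow> AE \<omega> in M. norm (U i \<omega>) = 1"
proof -
  assume i: "i \<ge> 1"
  have "AE x in distr M borel (U i). norm x = 1"
    unfolding distr_U[OF i] using AE_uniform_circle_eq_circle_point
    by eventually_elim (auto simp: norm_circle_point)
  then show ?thesis using U_measurable[OF i] by (subst (asm) AE_distr_iff) auto
qed

definition near_event :: "real \<Rightarrow> nat set \<Rightarrow> 'a set" where
  "near_event e A = {\<omega>\<in>space M. near_equilateral e (\<lambda>i. U i \<omega>) A}"

lemma restrict_U_measurable: "A \<subseteq> {1..} \<Longrightarrow> (\<lambda>\<omega>. restrict (\<lambda>i. U i \<omega>) A) \<in> measurable M (PiM A (\<lambda>_. borel))"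
  by (intro measurable_restrict U_measurable) auto

lemma near_event_sets: "A \<subseteq> {1..} \<Longrightarrow> near_event e A \<in> events"
proof -
  assume A: "A \<subseteq> {1..}"
  have "near_event e A = (\<lambda>\<omega>. restrict (\<lambda>i. U i \<omega>) A) -` {u \<in> space (PiM A (\<lambda>_. borel)). near_equilateral e u A} \<inter> space M"
    using measurable_space[OF restrict_U_measurable[OF A]] by (auto simp: near_event_def)
  then show ?thesis using measurable_sets[OF restrict_U_measurable[OF A] near_equilateral_sets[OF subset_refl]] by (simp only:)
qed

text \<open>The vertex of largest index is integrated out first; the joint law of the other two is a
  product, which leads to the iterated integral already computed.\<close>

lemma near_event_prob:
  assumes A: "card A = 3" "A \<subseteq> {1..}" and e: "0 < e" "e \<le> 1 / 100"
  shows "prob (near_event e A) = measure lborel (angle_region e) / (4 * pi\<^sup>2)"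
proof -
  obtain i j l where A_eq: "A = {i, j, l}" and ord: "i < j" "j < l" using card_3_increasing[OF A(1)] .
  have i1: "i \<ge> 1" "j \<ge> 1" "l \<ge> 1" using A A_eq by auto
  interpret circ: prob_space uniform_circle by (rule prob_space_uniform_circle)
  let ?B = "borel :: (real^2) measure"
  let ?S = "{w \<in> space ((?B \<Otimes>\<^sub>M ?B) \<Otimes>\<^sub>M ?B). 3 * sqrt 3 - peri (fst (fst w)) (snd (fst w)) (snd w) \<le> e}"
  have S: "?S \<in> sets ((?B \<Otimes>\<^sub>M ?B) \<Otimes>\<^sub>M ?B)" by measurable
  have cij: "(\<lambda>u. (u i, u j)) \<in> measurable (PiM {i, j} (\<lambda>_. ?B)) (?B \<Otimes>\<^sub>M ?B)"
    by (intro measurable_Pair measurable_component_singleton) auto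
  have c1: "(\<lambda>u. u k) \<in> measurable (PiM {k} (\<lambda>_. ?B)) ?B" for k
    by (intro measurable_component_singleton) auto
  have dij: "distr M (?B \<Otimes>\<^sub>M ?B) (\<lambda>\<omega>. (U i \<omega>, U j \<omega>)) = uniform_circle \<Otimes>\<^sub>M uniform_circle"
  proof -
    have "indep_var (PiM {i} (\<lambda>_. ?B)) (\<lambda>\<omega>. restrict (\<lambda>i. U i \<omega>) {i}) (PiM {j} (\<lambda>_. ?B)) (\<lambda>\<omega>. restrict (\<lambda>i. U i \<omega>) {j})"
      using ord i1 by (intro indep_var_restrict[OF indep]) auto
    from indep_var_compose[OF this c1 c1] have "indep_var ?B (U i) ?B (U j)"
      by (simp add: comp_def)
    then show ?thesis unfolding indep_var_distribution_eq by (metis distr_U i1(1,2))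
  qed
  let ?Z = "\<lambda>\<omega>. restrict (\<lambda>i. U i \<omega>) {i, j}"
  let ?P = "PiM {i, j} (\<lambda>_. ?B)"
  let ?S' = "{w \<in> space (?P \<Otimes>\<^sub>M ?B). ((fst w i, fst w j), snd w) \<in> ?S}"
  have Zm: "?Z \<in> measurable M ?P"
    using i1 by (intro measurable_restrict U_measurable) auto
  have S': "?S' \<in> sets (?P \<Otimes>\<^sub>M ?B)"
  proof -
    have "(\<lambda>w. ((fst w i, fst w j), snd w)) \<in> measurable (?P \<Otimes>\<^sub>M ?B) ((?B \<Otimes>\<^sub>M ?B) \<Otimes>\<^sub>M ?B)"
      by (intro measurable_Pair measurable_compose[OF measurable_fst measurable_component_singleton] measurable_snd) auto
    from measurable_sets[OF this S] show ?thesis by (simp add: vimage_def Int_def conj_commute)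
  qed
  have g: "(\<lambda>z. emeasure uniform_circle (Pair z -` ?S)) \<in> borel_measurable (?B \<Otimes>\<^sub>M ?B)"
  proof -
    have "sets ((?B \<Otimes>\<^sub>M ?B) \<Otimes>\<^sub>M uniform_circle) = sets ((?B \<Otimes>\<^sub>M ?B) \<Otimes>\<^sub>M ?B)"
      by (intro sets_pair_measure_cong sets_uniform_circle refl)
    then show ?thesis using S by (intro circ.measurable_emeasure_Pair) simp
  qed
  have "near_event e A = {\<omega>\<in>space M. (?Z \<omega>, U l \<omega>) \<in> ?S'}"
    using measurable_space[OF Zm]
    by (auto simp: near_event_def A_eq near_equilateral_triple[OF ord] space_pair_measure)
  then have "emeasure M (near_event e A) = (\<integral>\<^sup>+ z. emeasure uniform_circle (Pair z -` ?S') \<partial>distr M ?P ?Z)"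
    using emeasure_indep_vars_insert[OF indep _ _ _ S'] ord i1 by (simp add: distr_U)
  also have "\<dots> = (\<integral>\<^sup>+ z. emeasure uniform_circle (Pair (z i, z j) -` ?S) \<partial>distr M ?P ?Z)"
    by (intro nn_integral_cong arg_cong[where f = "emeasure uniform_circle"]) (auto simp: space_pair_measure)
  also have "\<dots> = (\<integral>\<^sup>+ \<omega>. emeasure uniform_circle (Pair (U i \<omega>, U j \<omega>) -` ?S) \<partial>M)"
    using measurable_compose[OF cij g] by (subst nn_integral_distr[OF Zm]) simp_all
  also have "\<dots> = (\<integral>\<^sup>+ z. emeasure uniform_circle (Pair z -` ?S) \<partial>(uniform_circle \<Otimes>\<^sub>M uniform_circle))"
    unfolding dij[symmetric] using g i1 U_measurable by (subst nn_integral_distr) simp_all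
  also have "\<dots> = (\<integral>\<^sup>+ x. \<integral>\<^sup>+ y. emeasure uniform_circle (Pair (x, y) -` ?S) \<partial>uniform_circle \<partial>uniform_circle)"
  proof (rule circ.nn_integral_fst[symmetric])
    have "sets (uniform_circle \<Otimes>\<^sub>M uniform_circle) = sets (?B \<Otimes>\<^sub>M ?B)"
      by (intro sets_pair_measure_cong sets_uniform_circle)
    then show "(\<lambda>z. emeasure uniform_circle (Pair z -` ?S)) \<in> borel_measurable (uniform_circle \<Otimes>\<^sub>M uniform_circle)"
      using g measurable_cong_sets by blast
  qed
  also have "\<dots> = (\<integral>\<^sup>+ x. \<integral>\<^sup>+ y. emeasure uniform_circle {z. 3 * sqrt 3 - peri x y z \<le> e} \<partial>uniform_circle \<partial>uniform_circle)"
    by (simp add: space_pair_measure vimage_def)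
  also have "\<dots> = ennreal (measure lborel (angle_region e)) / ennreal (4 * pi\<^sup>2)"
    unfolding near_equilateral_probability using angle_region_bounds(2)[OF e] by simp
  also have "\<dots> = ennreal (measure lborel (angle_region e) / (4 * pi\<^sup>2))"
    by (rule divide_ennreal) auto
  finally show ?thesis by (simp add: emeasure_eq_measure)
qed

lemma near_event_prob_bounds:
  assumes A: "card A = 3" "A \<subseteq> {1..}" and e: "0 < e" "e \<le> 1 / 100"
  shows "\<bar>prob (near_event e A) - 4 * e / (3 * pi)\<bar> \<le> 2 * (e * sqrt e)" "prob (near_event e A) \<le> e"
proof -
  have pi9: "9 \<le> pi\<^sup>2" using pi_gt3 power_mono[of 3 pi 2] by simp
  have "16 * pi * e / 3 / (4 * pi\<^sup>2) = 4 * e / (3 * pi)"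
    by (simp add: power2_eq_square field_simps)
  then have "prob (near_event e A) - 4 * e / (3 * pi) = (measure lborel (angle_region e) - 16 * pi * e / 3) / (4 * pi\<^sup>2)"
    unfolding near_event_prob[OF A e] diff_divide_distrib by (rule arg_cong[OF sym])
  then have "\<bar>prob (near_event e A) - 4 * e / (3 * pi)\<bar>
      = \<bar>measure lborel (angle_region e) - 16 * pi * e / 3\<bar> / (4 * pi\<^sup>2)"
    by (simp only: abs_divide) simp
  \<comment> \<open>The square of pi is replaced by 9; 60/36 is below 2.\<close>
  also have "\<dots> \<le> 60 * (e * sqrt e) / (4 * 9)"
    using angle_region_bounds(1)[OF e] pi9 e by (intro frac_le) auto
  also have "\<dots> \<le> 2 * (e * sqrt e)" using e by simp
  finally show *: "\<bar>prob (near_event e A) - 4 * e / (3 * pi)\<bar> \<le> 2 * (e * sqrt e)" .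
  have "sqrt e \<le> sqrt ((1 / 10)\<^sup>2)" using e by (simp add: power2_eq_square)
  then have "e * sqrt e \<le> e * (1 / 10)" using e by (intro mult_left_mono) auto
  moreover have "4 * e / (3 * pi) \<le> 4 * e / (3 * 3)" using e pi_gt3 by (intro frac_le mult_left_mono) auto
  ultimately show "prob (near_event e A) \<le> e" using * by (simp add: abs_le_iff)
qed

text \<open>All other vertices of the two triangles have distance about \<open>sqrt 3\<close> from
  the shared vertex \<open>i\<close>. They form a star with centre \<open>i\<close>, whose number of
  leaves is the exponent.\<close>

lemma near_event_Int_prob_le:
  assumes A: "card A = 3" "A \<subseteq> {1..}" and B: "card B = 3" "B \<subseteq> {1..}" and i: "i \<in> A" "i \<in> B" and e: "0 \<le> e"
  shows "prob (near_event e A \<inter> near_event e B) \<le> (24 * sqrt e) ^ (5 - card (A \<inter> B))"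
proof -
  let ?K = "A \<union> B - {i}"
  \<comment> \<open>The norm condition empties the sections at points off the circle, so the section
    bound holds for every centre, as the star bound demands.\<close>
  define R :: "((real^2) \<times> (real^2)) set" where
    "R = {w \<in> space (borel \<Otimes>\<^sub>M borel). norm (fst w) = 1 \<and> \<bar>norm (fst w - snd w) - sqrt 3\<bar> \<le> 6 * sqrt e}"
  have R: "R \<in> sets (borel \<Otimes>\<^sub>M borel)" unfolding R_def by measurable
  have fin: "finite A" "finite B" using A B by (auto intro: card_ge_0_finite)
  have cK: "card ?K = 5 - card (A \<inter> B)"
    using card_Un_Int[OF fin] A B i fin by (simp add: card_Diff_singleton)
  have Rle: "emeasure uniform_circle (Pair x -` R) \<le> ennreal (24 * sqrt e)" for x
  proof (cases "norm x = 1")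
    case True
    then obtain a where a: "a \<in> {0..2*pi}" "x = circle_point a"
      using circle_point_onto[of x 0] by auto
    show ?thesis
      using uniform_circle_side_le[OF _ a(1), of "6 * sqrt e"] True e
      by (simp add: R_def vimage_def space_pair_measure a(2))
  next
    case False
    then have "Pair x -` R = {}" by (auto simp: R_def)
    then show ?thesis by simp
  qed
  have "prob (near_event e A \<inter> near_event e B) \<le> prob {\<omega>\<in>space M. \<forall>k\<in>?K. (U i \<omega>, U k \<omega>) \<in> R}"
  proof (rule finite_measure_mono_AE)
    \<comment> \<open>The points lie on the circle only almost surely, hence an inclusion up to null
      sets.\<close>
    have "AE \<omega> in M. \<forall>k\<in>A \<union> B. norm (U k \<omega>) = 1"
      using A B fin by (intro AE_finite_allI AE_norm_U) auto
    then show "AE \<omega> in M. \<omega> \<in> near_event e A \<inter> near_event e B \<longrightarrow> \<omega> \<in> {\<omega>\<in>space M. \<forall>k\<in>?K. (U i \<omega>, U k \<omega>) \<in> R}"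
    proof eventually_elim
      case (elim \<omega>)
      show ?case
        using elim i near_equilateral_side[OF A(1) i(1), of _ "\<lambda>k. U k \<omega>" e]
          near_equilateral_side[OF B(1) i(2), of _ "\<lambda>k. U k \<omega>" e]
        by (auto simp: near_event_def R_def space_pair_measure)
    qed
    have "{\<omega>\<in>space M. (U i \<omega>, U k \<omega>) \<in> R} \<in> events" if "k \<in> ?K" for k
    proof -
      have "k \<ge> 1" "i \<ge> 1" using that A B i by auto
      from measurable_sets[OF measurable_Pair[OF U_measurable U_measurable, OF this(2,1)] R]
      show ?thesis by (simp add: vimage_def Int_def conj_commute)
    qed
    then show "{\<omega>\<in>space M. \<forall>k\<in>?K. (U i \<omega>, U k \<omega>) \<in> R} \<in> events"
      using fin by (intro sets.sets_Collect_finite_All) auto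
  qed
  also have "\<dots> \<le> (24 * sqrt e) ^ card ?K"
  proof (rule indep_star_prob_le[OF indep _ _ _ _ R])
    fix k x assume "k \<in> ?K"
    then have "k \<ge> 1" using A B by auto
    then show "emeasure (distr M borel (U k)) (Pair x -` R) \<le> ennreal (24 * sqrt e)"
      using Rle by (simp add: distr_U)
  qed (use A B i e fin in auto)
  finally show ?thesis unfolding cK .
qed

end

section \<open>Convergence of the maximal perimeter\<close>

definition triples :: "nat \<Rightarrow> nat set set" where
  "triples n = {A. A \<subseteq> {1..n} \<and> card A = 3}"

lemma finite_triples: "finite (triples n)"
  by (rule finite_subset[of _ "Pow {1..n}"]) (auto simp: triples_def)

lemma card_triples: "card (triples n) = n choose 3"
  using n_subsets[of "{1..n}" 3] by (simp add: triples_def)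

lemma real_choose_3:
  assumes "3 \<le> n"
  shows "real (n choose 3) = (real n ^ 3 - 3 * real n ^ 2 + 2 * real n) / 6"
proof -
  have "real (n choose 3) = (real n * (real n - 1) * (real n - 2)) / 6"
    by (simp add: binomial_gbinomial gbinomial_prod_rev numeral_3_eq_3 fact_numeral atLeast0LessThan lessThan_Suc)
  then show ?thesis by (simp add: power2_eq_square power3_eq_cube algebra_simps)
qed

lemma card_triples_le: "card (triples n) \<le> n ^ 3"
  unfolding card_triples using binomial_le_pow[of 3 n] by (cases "3 \<le> n") (auto simp: binomial_eq_0)

lemma card_triples_meeting_le:
  assumes "A \<in> triples n"
  shows "card {B \<in> triples n. A \<inter> B \<noteq> {}} \<le> 3 * n\<^sup>2"
proof -
  have A: "finite A" "card A = 3" using assms by (auto simp: triples_def intro: card_ge_0_finite)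
  have "{B \<in> triples n. A \<inter> B \<noteq> {}} \<subseteq> (\<lambda>(i, j, l). {i, j, l}) ` (A \<times> {1..n} \<times> {1..n})"
  proof
    fix B assume "B \<in> {B \<in> triples n. A \<inter> B \<noteq> {}}"
    then obtain i where i: "i \<in> A" "i \<in> B" and B: "B \<subseteq> {1..n}" "card B = 3" by (auto simp: triples_def)
    from B(2) i(2) have "card (B - {i}) = 2" by simp
    then obtain j l where "B - {i} = {j, l}" by (auto simp: card_2_iff)
    then have "B = {i, j, l}" using i by auto
    moreover have "j \<in> {1..n}" "l \<in> {1..n}" using \<open>B = {i, j, l}\<close> B by auto
    ultimately show "B \<in> (\<lambda>(i, j, l). {i, j, l}) ` (A \<times> {1..n} \<times> {1..n})" using i by (auto intro!: image_eqI[of _ _ "(i, j, l)"])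
  qed
  then have "card {B \<in> triples n. A \<inter> B \<noteq> {}} \<le> card (A \<times> {1..n} \<times> {1..n})"
    using A by (intro surj_card_le) auto
  then show ?thesis using A by (simp add: card_cartesian_product power2_eq_square)
qed

lemma card_triples_sharing_two_le:
  assumes "A \<in> triples n"
  shows "card {B \<in> triples n. 2 \<le> card (A \<inter> B)} \<le> 9 * n"
proof -
  have A: "finite A" "card A = 3" using assms by (auto simp: triples_def intro: card_ge_0_finite)
  have "{B \<in> triples n. 2 \<le> card (A \<inter> B)} \<subseteq> (\<lambda>(i, j, l). {i, j, l}) ` (A \<times> A \<times> {1..n})"
  proof
    fix B assume *: "B \<in> {B \<in> triples n. 2 \<le> card (A \<inter> B)}"
    then have B: "B \<subseteq> {1..n}" "card B = 3" by (auto simp: triples_def)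
    obtain P where "P \<subseteq> A \<inter> B" "card P = 2" using * by (auto elim: obtain_subset_with_card_n)
    then obtain i j where ij: "i \<noteq> j" "i \<in> A" "i \<in> B" "j \<in> A" "j \<in> B" by (auto simp: card_2_iff)
    then have "card (B - {i, j}) = 1" using B by (subst card_Diff_subset) auto
    then obtain l where "B - {i, j} = {l}" by (auto simp: card_1_singleton_iff)
    then have "B = {i, j, l}" using ij by auto
    moreover have "l \<in> {1..n}" using \<open>B = {i, j, l}\<close> B by auto
    ultimately show "B \<in> (\<lambda>(i, j, l). {i, j, l}) ` (A \<times> A \<times> {1..n})" using ij by (auto intro!: image_eqI[of _ _ "(i, j, l)"])
  qed
  then have "card {B \<in> triples n. 2 \<le> card (A \<inter> B)} \<le> card (A \<times> A \<times> {1..n})"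
    using A by (intro surj_card_le) auto
  then show ?thesis using A by (simp add: card_cartesian_product)
qed

lemma max_peri_near_equilateral:
  assumes n: "3 \<le> n"
  shows "real n ^ 3 * (3 * sqrt 3 - max_peri u n) \<le> t \<longleftrightarrow> (\<exists>A\<in>triples n. near_equilateral (t / real n ^ 3) u A)"
proof -
  let ?S = "{peri (u i) (u j) (u l) | i j l. 1 \<le> i \<and> i < j \<and> j < l \<and> l \<le> n}"
  have "?S \<subseteq> (\<lambda>(i, j, l). peri (u i) (u j) (u l)) ` ({..n} \<times> {..n} \<times> {..n})"
    by (auto intro!: image_eqI[of _ _ "(_, _, _)"])
  then have fin: "finite ?S" by (rule finite_subset) simp
  \<comment> \<open>Nonemptiness is where \<open>3 \<le> n\<close> matters: the maximum over the
    empty set is unspecified.\<close>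
  have "peri (u 1) (u 2) (u 3) \<in> ?S" using n by (intro CollectI exI[of _ 1] exI[of _ 2] exI[of _ 3]) simp
  then have ne: "?S \<noteq> {}" by blast
  have "real n ^ 3 * (3 * sqrt 3 - max_peri u n) \<le> t \<longleftrightarrow> 3 * sqrt 3 - t / real n ^ 3 \<le> Max ?S"
    using n by (simp add: max_peri_def field_simps)
  also have "\<dots> \<longleftrightarrow> (\<exists>p\<in>?S. 3 * sqrt 3 - t / real n ^ 3 \<le> p)" by (rule Max_ge_iff[OF fin ne])
  also have "\<dots> \<longleftrightarrow> (\<exists>A\<in>triples n. near_equilateral (t / real n ^ 3) u A)"
  proof
    assume "\<exists>p\<in>?S. 3 * sqrt 3 - t / real n ^ 3 \<le> p"
    then obtain i j l where ijl: "1 \<le> i" "i < j" "j < l" "l \<le> n"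
      and "3 * sqrt 3 - t / real n ^ 3 \<le> peri (u i) (u j) (u l)" by blast
    then have "near_equilateral (t / real n ^ 3) u {i, j, l}" by (simp add: near_equilateral_triple)
    moreover have "{i, j, l} \<in> triples n" using ijl by (auto simp: triples_def)
    ultimately show "\<exists>A\<in>triples n. near_equilateral (t / real n ^ 3) u A" by blast
  next
    assume "\<exists>A\<in>triples n. near_equilateral (t / real n ^ 3) u A"
    then obtain A i j l where A: "A \<subseteq> {1..n}" and ijl: "i \<in> A" "j \<in> A" "l \<in> A" "i < j" "j < l"
        and d: "3 * sqrt 3 - peri (u i) (u j) (u l) \<le> t / real n ^ 3"
      by (auto simp: triples_def near_equilateral_def)
    have "1 \<le> i" "l \<le> n" using A ijl by auto
    then have "peri (u i) (u j) (u l) \<in> ?S" using ijl by blast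
    moreover have "3 * sqrt 3 - t / real n ^ 3 \<le> peri (u i) (u j) (u l)" using d by linarith
    ultimately show "\<exists>p\<in>?S. 3 * sqrt 3 - t / real n ^ 3 \<le> p" by blast
  qed
  finally show ?thesis .
qed

section \<open>Void probability, mean and rate\<close>

context circle_sample
begin

text \<open>The count over triples disjoint from \<open>A\<close> is a function of the points with
  index outside \<open>A\<close>, hence independent of the event of \<open>A\<close>.\<close>

lemma near_event_dissociated:
  assumes A: "A \<in> triples n" and s: "0 \<le> s" "s \<le> 1"
  shows "expectation (\<lambda>\<omega>. indicator (near_event e A) \<omega> * s ^ card {B \<in> triples n - {B \<in> triples n. A \<inter> B \<noteq> {}}. \<omega> \<in> near_event e B})
    = prob (near_event e A) * expectation (\<lambda>\<omega>. s ^ card {B \<in> triples n - {B \<in> triples n. A \<inter> B \<noteq> {}}. \<omega> \<in> near_event e B})"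
proof -
  define D where "D = triples n - {B \<in> triples n. A \<inter> B \<noteq> {}}"
  let ?C = "{1..n} - A"
  have D: "finite D" "\<And>B. B \<in> D \<Longrightarrow> B \<subseteq> ?C" by (auto simp: D_def triples_def finite_triples)
  have A1: "A \<subseteq> {1..}" using A by (auto simp: triples_def)
  define f where "f u = (if near_equilateral e u A then 1 else 0 :: real)" for u
  define g where "g u = s ^ card {B \<in> D. near_equilateral e u B}" for u
  let ?Z = "\<lambda>\<omega>. restrict (\<lambda>i. U i \<omega>) A" and ?Y = "\<lambda>\<omega>. restrict (\<lambda>i. U i \<omega>) ?C"
  have f: "f \<in> borel_measurable (PiM A (\<lambda>_. borel))"
    unfolding f_def using near_equilateral_sets[OF subset_refl] by (intro measurable_If) auto
  have g: "g \<in> borel_measurable (PiM ?C (\<lambda>_. borel))"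
    unfolding g_def using D near_equilateral_sets
    by (intro measurable_compose[OF measurable_card_Collect, of _ _ _ "\<lambda>k. s ^ k"]) auto
  have "indep_var (PiM A (\<lambda>_. borel)) ?Z (PiM ?C (\<lambda>_. borel)) ?Y"
    using A1 by (intro indep_var_restrict[OF indep]) auto
  from indep_var_compose[OF this f g] have ind: "indep_var borel (\<lambda>\<omega>. f (?Z \<omega>)) borel (\<lambda>\<omega>. g (?Y \<omega>))"
    by (simp add: comp_def)
  have mf: "(\<lambda>\<omega>. f (?Z \<omega>)) \<in> borel_measurable M" and mg: "(\<lambda>\<omega>. g (?Y \<omega>)) \<in> borel_measurable M"
    using ind unfolding indep_var_distribution_eq by auto
  have "\<bar>g u\<bar> \<le> 1" for u using s by (simp add: g_def power_le_one)
  then have ig: "integrable M (\<lambda>\<omega>. g (?Y \<omega>))"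
    by (intro integrable_const_bound[of _ 1] mg) auto
  have if': "integrable M (\<lambda>\<omega>. f (?Z \<omega>))"
    by (intro integrable_const_bound[of _ 1] mf) (auto simp: f_def)
  have f_eq: "f (?Z \<omega>) = indicator (near_event e A) \<omega>" if "\<omega> \<in> space M" for \<omega>
    using that by (simp add: f_def near_event_def)
  have g_eq: "g (?Y \<omega>) = s ^ card {B \<in> D. \<omega> \<in> near_event e B}" if "\<omega> \<in> space M" for \<omega>
  proof -
    have "near_equilateral e (?Y \<omega>) B \<longleftrightarrow> \<omega> \<in> near_event e B" if "B \<in> D" for B
    proof -
      have "near_equilateral e (?Y \<omega>) B = near_equilateral e (\<lambda>i. U i \<omega>) B"
        by (rule near_equilateral_cong) (use D(2)[OF that] in auto)
      then show ?thesis using \<open>\<omega> \<in> space M\<close> by (simp add: near_event_def)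
    qed
    then have "{B \<in> D. near_equilateral e (?Y \<omega>) B} = {B \<in> D. \<omega> \<in> near_event e B}" by blast
    then show ?thesis by (simp only: g_def)
  qed
  have "expectation (\<lambda>\<omega>. indicator (near_event e A) \<omega> * s ^ card {B \<in> D. \<omega> \<in> near_event e B})
      = expectation (\<lambda>\<omega>. f (?Z \<omega>) * g (?Y \<omega>))"
    by (intro Bochner_Integration.integral_cong) (simp_all only: f_eq g_eq)
  also have "\<dots> = expectation (\<lambda>\<omega>. f (?Z \<omega>)) * expectation (\<lambda>\<omega>. g (?Y \<omega>))"
    by (rule indep_var_lebesgue_integral[OF ind if' ig])
  also have "expectation (\<lambda>\<omega>. f (?Z \<omega>)) = expectation (indicator (near_event e A))"
    by (intro Bochner_Integration.integral_cong) (simp_all only: f_eq)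
  also have "\<dots> = prob (near_event e A)" using near_event_sets[OF A1] by (simp add: emeasure_eq_measure)
  also have "expectation (\<lambda>\<omega>. g (?Y \<omega>)) = expectation (\<lambda>\<omega>. s ^ card {B \<in> D. \<omega> \<in> near_event e B})"
    by (intro Bochner_Integration.integral_cong) (simp_all only: g_eq)
  finally show ?thesis unfolding D_def .
qed

text \<open>The three summands come from products of probabilities, from pairs of triples sharing
  one point, and from pairs sharing two, of which each triple has only \<open>O(n)\<close>.\<close>

lemma near_event_void_bound:
  assumes e: "0 < e" "e \<le> 1 / 100"
  shows "\<bar>prob {\<omega>\<in>space M. \<forall>A\<in>triples n. \<omega> \<notin> near_event e A} - exp (- (\<Sum>A\<in>triples n. prob (near_event e A)))\<bar>
    \<le> real n ^ 3 * (3 * real n ^ 2 * e ^ 2 + 3 * real n ^ 2 * (24 * sqrt e) ^ 4 + 9 * real n * (24 * sqrt e) ^ 3)"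
proof -
  define N where "N A = {B \<in> triples n. A \<inter> B \<noteq> {}}" for A
  have fN: "finite (N A)" for A unfolding N_def using finite_triples by simp
  have tr: "card A = 3" "A \<subseteq> {1..}" if "A \<in> triples n" for A using that by (auto simp: triples_def)
  have "\<bar>prob {\<omega>\<in>space M. \<forall>A\<in>triples n. \<omega> \<notin> near_event e A} - exp (- (\<Sum>A\<in>triples n. prob (near_event e A)))\<bar>
    \<le> (\<Sum>A\<in>triples n. (\<Sum>B\<in>N A. prob (near_event e A) * prob (near_event e B))
        + (\<Sum>B\<in>N A - {A}. prob (near_event e A \<inter> near_event e B)))"
  proof (rule poisson_void_bound[OF finite_triples])
    fix A assume A: "A \<in> triples n"
    show "near_event e A \<in> events" using near_event_sets[OF tr(2)[OF A]] .
    show "N A \<subseteq> triples n" by (auto simp: N_def)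
    show "A \<in> N A" using A tr(1)[OF A] by (auto simp: N_def)
  next
    fix A and s :: real assume "A \<in> triples n" "0 \<le> s" "s \<le> 1"
    then show "expectation (\<lambda>\<omega>. indicator (near_event e A) \<omega> * s ^ card {B \<in> triples n - N A. \<omega> \<in> near_event e B})
        = prob (near_event e A) * expectation (\<lambda>\<omega>. s ^ card {B \<in> triples n - N A. \<omega> \<in> near_event e B})"
      unfolding N_def by (rule near_event_dissociated)
  qed
  also have "\<dots> \<le> (\<Sum>A\<in>triples n. 3 * real n ^ 2 * e ^ 2 + 3 * real n ^ 2 * (24 * sqrt e) ^ 4 + 9 * real n * (24 * sqrt e) ^ 3)"
  proof (rule sum_mono)
    fix A assume A: "A \<in> triples n"
    have cN: "real (card (N A)) \<le> 3 * real n ^ 2"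
      using of_nat_mono[OF card_triples_meeting_le[OF A], where 'a = real] by (simp add: N_def)
    let ?T = "{B \<in> triples n. 2 \<le> card (A \<inter> B)}"
    have cT: "real (card ?T) \<le> 9 * real n"
      using of_nat_mono[OF card_triples_sharing_two_le[OF A], where 'a = real] by simp
    have "(\<Sum>B\<in>N A. prob (near_event e A) * prob (near_event e B)) \<le> (\<Sum>B\<in>N A. e * e)"
      using e near_event_prob_bounds(2)[OF tr e] A by (intro sum_mono mult_mono) (auto simp: N_def)
    also have "\<dots> = real (card (N A)) * e ^ 2" by (simp add: power2_eq_square)
    also have "\<dots> \<le> 3 * real n ^ 2 * e ^ 2" using cN by (intro mult_right_mono) auto
    finally have 1: "(\<Sum>B\<in>N A. prob (near_event e A) * prob (near_event e B)) \<le> 3 * real n ^ 2 * e ^ 2" .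
    \<comment> \<open>Distinct triples that meet share one or two points. The fourth power is
      charged to every neighbour, so that the exceptional ones merely add a term.\<close>
    have "prob (near_event e A \<inter> near_event e B) \<le> (24 * sqrt e) ^ 4 + (if B \<in> ?T then (24 * sqrt e) ^ 3 else 0)"
      if B: "B \<in> N A - {A}" for B
    proof -
      from B obtain i where i: "i \<in> A" "i \<in> B" and Bt: "B \<in> triples n" "A \<noteq> B" by (auto simp: N_def)
      have fin: "finite A" "finite B" using tr(1)[OF A] tr(1)[OF Bt(1)] by (auto intro: card_ge_0_finite)
      have "0 < card (A \<inter> B)" using i fin by (auto simp: card_gt_0_iff)
      moreover have "card (A \<inter> B) < 3"
      proof (rule ccontr)
        assume "\<not> card (A \<inter> B) < 3"
        moreover have "card (A \<inter> B) \<le> 3" using card_mono[OF fin(1), of "A \<inter> B"] tr(1)[OF A] by simp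
        ultimately have "A \<inter> B = A"
          using card_subset_eq[OF fin(1), of "A \<inter> B"] tr(1)[OF A] by simp
        then have "A = B" using card_subset_eq[OF fin(2), of A] tr(1)[OF A] tr(1)[OF Bt(1)] by auto
        with Bt show False by simp
      qed
      ultimately have "5 - card (A \<inter> B) = 4 \<or> (5 - card (A \<inter> B) = 3 \<and> B \<in> ?T)" using Bt by auto
      then show ?thesis
        by (intro order_trans[OF near_event_Int_prob_le[OF tr[OF A] tr[OF Bt(1)] i less_imp_le[OF e(1)]]])
          (use e in \<open>elim disjE conjE; simp\<close>)
    qed
    then have "(\<Sum>B\<in>N A - {A}. prob (near_event e A \<inter> near_event e B))
        \<le> (\<Sum>B\<in>N A - {A}. (24 * sqrt e) ^ 4 + (if B \<in> ?T then (24 * sqrt e) ^ 3 else 0))"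
      by (rule sum_mono)
    also have "\<dots> \<le> (\<Sum>B\<in>N A. (24 * sqrt e) ^ 4 + (if B \<in> ?T then (24 * sqrt e) ^ 3 else 0))"
      using e fN by (intro sum_mono2) auto
    also have "\<dots> = real (card (N A)) * (24 * sqrt e) ^ 4 + real (card (N A \<inter> ?T)) * (24 * sqrt e) ^ 3"
      using fN by (simp add: sum.distrib sum.If_cases Int_def)
    also have "\<dots> \<le> 3 * real n ^ 2 * (24 * sqrt e) ^ 4 + 9 * real n * (24 * sqrt e) ^ 3"
    proof (intro add_mono mult_right_mono cN)
      have "card (N A \<inter> ?T) \<le> card ?T" using finite_triples by (intro card_mono) auto
      then show "real (card (N A \<inter> ?T)) \<le> 9 * real n" using cT by linarith
    qed (use e in auto)
    finally show "(\<Sum>B\<in>N A. prob (near_event e A) * prob (near_event e B))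
        + (\<Sum>B\<in>N A - {A}. prob (near_event e A \<inter> near_event e B))
      \<le> 3 * real n ^ 2 * e ^ 2 + 3 * real n ^ 2 * (24 * sqrt e) ^ 4 + 9 * real n * (24 * sqrt e) ^ 3"
      using 1 by linarith
  qed
  also have "\<dots> = real (card (triples n)) * (3 * real n ^ 2 * e ^ 2 + 3 * real n ^ 2 * (24 * sqrt e) ^ 4 + 9 * real n * (24 * sqrt e) ^ 3)"
    by simp
  also have "\<dots> \<le> real n ^ 3 * (3 * real n ^ 2 * e ^ 2 + 3 * real n ^ 2 * (24 * sqrt e) ^ 4 + 9 * real n * (24 * sqrt e) ^ 3)"
    using card_triples_le[of n] e
    by (intro mult_right_mono) (auto simp flip: of_nat_power)
  finally show ?thesis .
qed

text \<open>The number of triples is \<open>n^3 / 6\<close> up to \<open>O(n^2)\<close>, and a sixth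
  of \<open>4 / (3 * pi)\<close> is \<open>2 / (9 * pi)\<close>. The two error terms come from the
  probability and from the count.\<close>

lemma near_event_mean_bound:
  assumes e: "0 < e" "e \<le> 1 / 100" and n: "3 \<le> n"
  shows "\<bar>(\<Sum>A\<in>triples n. prob (near_event e A)) - 2 * (real n ^ 3 * e) / (9 * pi)\<bar>
    \<le> 2 * real n ^ 3 * (e * sqrt e) + real n ^ 2 * e"
proof -
  define c where "c = real (n choose 3)"
  have c: "c = (real n ^ 3 - 3 * real n ^ 2 + 2 * real n) / 6" unfolding c_def by (rule real_choose_3[OF n])
  have c_le: "c \<le> real n ^ 3"
    using of_nat_mono[OF card_triples_le[of n], where 'a = real] by (simp add: c_def card_triples)
  have "real n * 3 \<le> real n ^ 2" using n by (simp add: power2_eq_square)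
  then have c6: "\<bar>c - real n ^ 3 / 6\<bar> \<le> real n ^ 2" unfolding c by (simp add: abs_le_iff field_simps)
  have "(\<Sum>A\<in>triples n. prob (near_event e A)) - c * (4 * e / (3 * pi))
      = (\<Sum>A\<in>triples n. prob (near_event e A) - 4 * e / (3 * pi))"
    by (simp add: sum_subtractf card_triples c_def)
  also have "\<bar>\<dots>\<bar> \<le> (\<Sum>A\<in>triples n. 2 * (e * sqrt e))"
    by (rule order_trans[OF sum_abs], intro sum_mono near_event_prob_bounds(1) e) (auto simp: triples_def)
  also have "\<dots> = c * (2 * (e * sqrt e))" by (simp add: card_triples c_def)
  also have "\<dots> \<le> real n ^ 3 * (2 * (e * sqrt e))" using c_le e by (intro mult_right_mono) auto
  finally have 1: "\<bar>(\<Sum>A\<in>triples n. prob (near_event e A)) - c * (4 * e / (3 * pi))\<bar> \<le> 2 * real n ^ 3 * (e * sqrt e)" by simp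
  have "c * (4 * e / (3 * pi)) - 2 * (real n ^ 3 * e) / (9 * pi) = (c - real n ^ 3 / 6) * (4 * e / (3 * pi))"
    by (simp add: field_simps)
  also have "\<bar>\<dots>\<bar> \<le> real n ^ 2 * e"
    unfolding abs_mult
  proof (rule mult_mono[OF c6])
    have "4 * e / (3 * pi) \<le> 4 * e / 4" using e pi_gt3 by (intro frac_le) auto
    then show "\<bar>4 * e / (3 * pi)\<bar> \<le> e" using e by simp
  qed auto
  finally show ?thesis using 1 by linarith
qed

lemma max_peri_prob_rate:
  assumes t: "0 < t" and n: "3 \<le> n" "100 * t \<le> real n"
  shows "\<bar>prob {\<omega>\<in>space M. real n ^ 3 * (3 * sqrt 3 - max_peri (\<lambda>i. U i \<omega>) n) \<le> t} - (1 - exp (- (2 * t / (9 * pi))))\<bar>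
    \<le> ((3 + 3 * 24 ^ 4) * t ^ 2 + (9 * 24 ^ 3 + 2) * (t * sqrt t) + t) * real n powr (- (1 / 2))"
proof -
  define e where "e = t / real n ^ 3"
  define V where "V = {\<omega>\<in>space M. \<forall>A\<in>triples n. \<omega> \<notin> near_event e A}"
  define \<mu> where "\<mu> = (\<Sum>A\<in>triples n. prob (near_event e A))"
  define x where "x = real n"
  have x: "3 \<le> x" "100 * t \<le> x" using n by (auto simp: x_def)
  have e0: "0 < e" using t x by (simp add: e_def x_def)
  \<comment> \<open>The hypothesis \<open>100 * t \<le> n\<close> serves to make \<open>e\<close> at
    most 1/100.\<close>
  have "x \<le> x ^ 3" using power_increasing[of 1 3 x] x by simp
  then have "100 * t \<le> x ^ 3" using x by linarith
  then have e: "0 < e" "e \<le> 1 / 100" using e0 x by (auto simp: e_def x_def[symmetric] field_simps)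
  have V: "V \<in> events"
  proof -
    have "V = space M - (\<Union>A\<in>triples n. near_event e A)" by (auto simp: V_def)
    moreover have "near_event e A \<in> events" if "A \<in> triples n" for A
      using that by (intro near_event_sets) (auto simp: triples_def)
    ultimately show ?thesis using finite_triples[of n]
      by (simp only:) (intro sets.Diff sets.top sets.finite_UN)
  qed
  have "{\<omega>\<in>space M. real n ^ 3 * (3 * sqrt 3 - max_peri (\<lambda>i. U i \<omega>) n) \<le> t} = space M - V"
    unfolding max_peri_near_equilateral[OF n(1)] V_def near_event_def e_def by auto
  then have P: "prob {\<omega>\<in>space M. real n ^ 3 * (3 * sqrt 3 - max_peri (\<lambda>i. U i \<omega>) n) \<le> t} = 1 - prob V"
    using prob_compl[OF V] by simp
  have xe: "x ^ 3 * e = t" using x by (simp add: e_def x_def)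
  \<comment> \<open>In terms of \<open>y\<close> the half-integer powers of \<open>n\<close> become
    integer powers.\<close>
  define y where "y = sqrt x"
  have y: "y > 0" "y ^ 2 = x" "1 \<le> y" using x by (auto simp: y_def)
  have se: "sqrt e = sqrt t / y ^ 3"
    unfolding e_def x_def[symmetric] y_def by (simp add: real_sqrt_divide real_sqrt_power)
  have e_y: "e = t / y ^ 6" unfolding e_def x_def[symmetric] y(2)[symmetric] by (simp flip: power_mult)
  have inv: "real n powr (- (1 / 2)) = 1 / y"
    using x unfolding x_def[symmetric] y_def by (simp add: powr_minus powr_half_sqrt inverse_eq_divide)
  have y2: "1 / y ^ 2 \<le> 1 / y" "1 / y ^ 3 \<le> 1 / y"
    using y power_increasing[of 1 2 y] power_increasing[of 1 3 y] by (auto intro!: divide_left_mono)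
  \<comment> \<open>With \<open>e\<close> of order \<open>n^-3\<close>, the terms
    \<open>n^5 * e^2\<close> are of order \<open>1 / n\<close>; only \<open>n^4 * e^(3/2)\<close>,
    from pairs sharing two points, has the order \<open>n^(-1/2)\<close>.\<close>
  have "real n ^ 3 * (3 * real n ^ 2 * e ^ 2 + 3 * real n ^ 2 * (24 * sqrt e) ^ 4 + 9 * real n * (24 * sqrt e) ^ 3)
      = (3 + 3 * 24 ^ 4) * t ^ 2 * (1 / y ^ 2) + 9 * 24 ^ 3 * (t * sqrt t) * (1 / y)"
  proof -
    have p4: "(24 * sqrt e) ^ 4 = 24 ^ 4 * e ^ 2"
      using e by (simp add: power_mult_distrib power4_eq_xxxx power2_eq_square)
    have p3: "(24 * sqrt e) ^ 3 = 24 ^ 3 * (e * sqrt e)"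
      using e by (simp add: power_mult_distrib power3_eq_cube)
    have "real n ^ 3 * (3 * real n ^ 2 * e ^ 2 + 3 * real n ^ 2 * (24 * sqrt e) ^ 4 + 9 * real n * (24 * sqrt e) ^ 3)
      = (3 + 3 * 24 ^ 4) * (x ^ 5 * e ^ 2) + 9 * 24 ^ 3 * (x ^ 4 * (e * sqrt e))"
      unfolding x_def p4 p3 by (simp add: algebra_simps power_numeral_reduce)
    moreover have "x ^ 5 * e ^ 2 = t ^ 2 * (1 / y ^ 2)"
      unfolding e_y y(2)[symmetric] using y(1) by (simp add: field_simps power_divide flip: power_mult power_add; simp add: power_numeral_reduce)
    moreover have "x ^ 4 * (e * sqrt e) = (t * sqrt t) * (1 / y)"
      unfolding se unfolding e_y y(2)[symmetric] using y(1) by (simp add: field_simps flip: power_mult power_add; simp add: power_numeral_reduce)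
    ultimately show ?thesis by simp
  qed
  then have b1: "\<bar>prob V - exp (- \<mu>)\<bar> \<le> (3 + 3 * 24 ^ 4) * t ^ 2 * (1 / y ^ 2) + 9 * 24 ^ 3 * (t * sqrt t) * (1 / y)"
    using near_event_void_bound[OF e, of n] unfolding V_def \<mu>_def by simp
  have "2 * real n ^ 3 * (e * sqrt e) + real n ^ 2 * e = 2 * (t * sqrt t) * (1 / y ^ 3) + t * (1 / y ^ 2)"
    unfolding se x_def[symmetric] unfolding e_y y(2)[symmetric]
    using y(1) by (simp add: field_simps flip: power_mult power_add; simp add: power_numeral_reduce)
  then have b2: "\<bar>\<mu> - 2 * t / (9 * pi)\<bar> \<le> 2 * (t * sqrt t) * (1 / y ^ 3) + t * (1 / y ^ 2)"
    using near_event_mean_bound[OF e n(1)] unfolding \<mu>_def x_def[symmetric] xe by simp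
  have exp_lip: "\<bar>exp (- a) - exp (- b)\<bar> \<le> \<bar>a - b\<bar>" if "0 \<le> a" "0 \<le> b" for a b :: real
  proof -
    have *: "exp (- a) - exp (- b) \<le> b - a" if "0 \<le> a" "a \<le> b" for a b :: real
    proof -
      have "exp (- a) - exp (- b) = exp (- a) * (1 - exp (- (b - a)))"
        by (simp add: algebra_simps flip: exp_add)
      also have "\<dots> \<le> 1 * (b - a)"
      proof (rule mult_mono)
        show "1 - exp (- (b - a)) \<le> b - a" using exp_ge_add_one_self[of "- (b - a)"] by linarith
      qed (use that in simp_all)
      finally show ?thesis by simp
    qed
    show ?thesis using *[of a b] *[of b a] that by (cases "a \<le> b") auto
  qed
  have "0 \<le> \<mu>" by (simp add: \<mu>_def sum_nonneg)
  then have b3: "\<bar>exp (- \<mu>) - exp (- (2 * t / (9 * pi)))\<bar> \<le> \<bar>\<mu> - 2 * t / (9 * pi)\<bar>"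
    using t by (intro exp_lip) auto
  have "\<bar>1 - prob V - (1 - exp (- (2 * t / (9 * pi))))\<bar> \<le> \<bar>prob V - exp (- \<mu>)\<bar> + \<bar>exp (- \<mu>) - exp (- (2 * t / (9 * pi)))\<bar>"
    by linarith
  also have "\<dots> \<le> (3 + 3 * 24 ^ 4) * t ^ 2 * (1 / y ^ 2) + 9 * 24 ^ 3 * (t * sqrt t) * (1 / y)
      + (2 * (t * sqrt t) * (1 / y ^ 3) + t * (1 / y ^ 2))"
    using b1 b2 b3 by linarith
  \<comment> \<open>As \<open>1 \<le> y\<close>, the faster decaying terms are absorbed into
    \<open>1 / y\<close>.\<close>
  also have "\<dots> \<le> (3 + 3 * 24 ^ 4) * t ^ 2 * (1 / y) + 9 * 24 ^ 3 * (t * sqrt t) * (1 / y)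
      + (2 * (t * sqrt t) * (1 / y) + t * (1 / y))"
    using y2 t by (intro add_mono mult_left_mono) auto
  also have "\<dots> = ((3 + 3 * 24 ^ 4) * t ^ 2 + (9 * 24 ^ 3 + 2) * (t * sqrt t) + t) * (1 / y)"
    by (simp add: algebra_simps)
  finally show ?thesis unfolding P inv .
qed

end

theorem theorem6p1:
  fixes M :: "'a measure" and U :: "nat \<Rightarrow> 'a \<Rightarrow> real^2" and t :: real
  assumes "prob_space M"
    and "prob_space.indep_vars M (\<lambda>_. borel) U {1..}"
    and "\<And>i. i \<ge> 1 \<Longrightarrow> distr M borel (U i) = uniform_circle"
    and "t > 0"
  shows "((\<lambda>n. measure M {\<omega> \<in> space M. real n ^ 3 * (3 * sqrt 3 - max_peri (\<lambda>i. U i \<omega>) n) \<le> t})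
            \<longlonglongrightarrow> 1 - exp (- (2 * t / (9 * pi)))) \<and>
         (\<lambda>n. \<bar>measure M {\<omega> \<in> space M. real n ^ 3 * (3 * sqrt 3 - max_peri (\<lambda>i. U i \<omega>) n) \<le> t}
              - (1 - exp (- (2 * t / (9 * pi))))\<bar>)
           \<in> O(\<lambda>n. real n powr (- (1 / 2)))"
proof -
  interpret prob_space M by fact
  interpret circle_sample M U using assms by unfold_locales
  let ?p = "\<lambda>n. measure M {\<omega> \<in> space M. real n ^ 3 * (3 * sqrt 3 - max_peri (\<lambda>i. U i \<omega>) n) \<le> t}"
  let ?L = "1 - exp (- (2 * t / (9 * pi)))"
  let ?C = "(3 + 3 * 24 ^ 4) * t ^ 2 + (9 * 24 ^ 3 + 2) * (t * sqrt t) + t"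
  have "eventually (\<lambda>n. 3 \<le> n \<and> 100 * t \<le> real n) sequentially"
    using eventually_ge_at_top[of 3] eventually_ge_at_top[of "nat \<lceil>100 * t\<rceil>"]
    by eventually_elim linarith
  then have bound: "eventually (\<lambda>n. \<bar>?p n - ?L\<bar> \<le> ?C * real n powr (- (1 / 2))) sequentially"
    by (rule eventually_mono) (rule max_peri_prob_rate[OF \<open>t > 0\<close>]; simp)
  have "(\<lambda>n. \<bar>?p n - ?L\<bar>) \<in> O(\<lambda>n. real n powr (- (1 / 2)))"
    using bound by (intro bigoI[of _ ?C]) simp
  \<comment> \<open>Convergence follows from the rate, since the bound tends to 0.\<close>
  moreover have "?p \<longlonglongrightarrow> ?L"
  proof -
    have "(\<lambda>n. real n powr (- (1 / 2))) \<longlonglongrightarrow> 0"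
      by (rule tendsto_neg_powr[OF _ filterlim_real_sequentially]) simp
    then have "(\<lambda>n. ?C * real n powr (- (1 / 2))) \<longlonglongrightarrow> 0" by (rule tendsto_mult_right_zero)
    then have "(\<lambda>n. ?p n - ?L) \<longlonglongrightarrow> 0"
      by (rule Lim_null_comparison[rotated]) (use bound in simp)
    then show ?thesis by (simp add: LIM_zero_iff)
  qed
  ultimately show ?thesis by blast
qed

end
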